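(* Assume the setting, Assumption A and Assumption B in the context. Let $m_j$ be the means of the Gaussian projected filter (Algorithm GPF) and $m^s_j$ those of the Gaussian projected filter with surrogate (Algorithm GPF-s), both with the same initialization $m_0,C_0$, the same observations, and inflation $Q=aP$. Then, if the inflation parameter $a>0$ is sufficiently large, there is a constant $\mathsf C_3$ independent of $\varepsilon$ and $\delta$ such that $$\limsup_{j\to\infty}\mathbb E\|m_j-m^s_j\|\le\mathsf C_3(\varepsilon+\delta).$$
   Context: $\mathcal H$ separable Hilbert space, $\Psi:\mathcal H\to\mathcal H$, $u_0\in\mathcal H$, signal $u_j=\Psi(u_{j-1})$; $H:\mathcal H\to\mathbb R^k$ linear with $HH^*=I_k$, $P:=H^*H$; observations $y_j=Hu_j+\varepsilon\eta_j$, $\varepsilon>0$, $\eta_j$ independent with mean zero and covariance $R$. $V(u):=(\|u\|^2+\beta\|Pu\|^2)^{1/2}$. Assumption A: there exist $r>0,\beta\ge0,L>0,\alpha\in(0,1)$ such that $\mathcal B=\{\|u\|\le r\}$ is absorbing and forward invariant for $\Psi$, $V^2(\Psi(u)-\Psi(v))\le LV^2(u-v)$ and $V^2((I-P)(\Psi(u)-\Psi(v)))\le\alpha V^2(u-v)$ for $u,v\in\mathcal B$. Assumption B on $\Psi^s:\mathcal H\to\mathcal H$: there exist $\kappa,L_s,\delta>0$ with $\|\Psi^s(u)-\Psi(u)\|\le\kappa$, $\|(I-P)(\Psi^s(u)-\Psi(u))\|\le\delta$ for $u\in\mathcal B$, and $V^2(\Psi^s(u)-\Psi^s(v))\le L_sV^2(u-v)$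 for $u,v\in\mathcal B$. $P_{\mathcal B_V}$: orthogonal projection onto $\mathcal B$ in the $V$-norm; $\mathscr K(\Sigma):=\Sigma H^*(H\Sigma H^*+\varepsilon^2R)^{-1}$. Algorithm GPF (for a map $F\in\{\Psi,\Psi^s\}$; $F=\Psi$ gives $m_j,C_j$, $F=\Psi^s$ gives GPF-s with $m^s_j,C^s_j$): starting from $m_0,C_0$, for $j\ge1$, $\mu_j=\mathbb E_{u\sim\mathcal N(m_{j-1},C_{j-1})}[F(P_{\mathcal B_V}u)]$, $\Sigma_j=\mathbb E_{u\sim\mathcal N(m_{j-1},C_{j-1})}[(F(P_{\mathcal B_V}u)-\mu_j)\otimes(F(P_{\mathcal B_V}u)-\mu_j)]$, $m_j=\mu_j+\mathscr K(\Sigma_j+Q)(y_j-H\mu_j)$, $C_j=(I-\mathscr K(\Sigma_j+Q)H)(\Sigma_j+Q)$ (all quantities carrying superscript $s$ when $F=\Psi^s$). Expectation over the observation noise. *)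

theory Defs
  imports "HOL-Analysis.Analysis" "HOL-Probability.Probability"
begin

definition normal_measure :: "real \<Rightarrow> real \<Rightarrow> real measure" where
  "normal_measure mu v =
     (if v = 0 then return borel mu else density lborel (normal_density mu (sqrt v)))"

definition is_gaussian :: "'a::{real_inner,polish_space} measure \<Rightarrow> 'a \<Rightarrow> ('a \<Rightarrow> 'a) \<Rightarrow> bool" where
  "is_gaussian M m C \<longleftrightarrow> prob_space M \<and> sets M = sets borel \<and>
     (\<forall>h. distr M borel (\<lambda>u. h \<bullet> u) = normal_measure (h \<bullet> m) (h \<bullet> C h))"

definition Vnorm :: "('a::real_inner \<Rightarrow> 'a) \<Rightarrow> real \<Rightarrow> 'a \<Rightarrow> real" where
  "Vnorm P \<beta> u = sqrt (norm u ^ 2 + \<beta> * norm (P u) ^ 2)"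

definition projBV :: "('a::real_inner \<Rightarrow> 'a) \<Rightarrow> real \<Rightarrow> real \<Rightarrow> 'a \<Rightarrow> 'a" where
  "projBV P \<beta> r u = (THE v. norm v \<le> r \<and>
       (\<forall>w. norm w \<le> r \<longrightarrow> Vnorm P \<beta> (u - v) \<le> Vnorm P \<beta> (u - w)))"

text \<open>Kalman gain K(S) = S H^* (H S H^* + eps^2 R)^{-1}, applied to a vector z;
  Ha is the adjoint H^* of H.\<close>
definition kgain :: "('a::real_inner \<Rightarrow> real^'k) \<Rightarrow> (real^'k \<Rightarrow> 'a) \<Rightarrow> real \<Rightarrow> real^'k^'k
     \<Rightarrow> ('a \<Rightarrow> 'a) \<Rightarrow> real^'k \<Rightarrow> 'a" where
  "kgain H Ha \<epsilon> R S z =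
     S (Ha (matrix_inv (matrix (\<lambda>w. H (S (Ha w))) + (\<epsilon>\<^sup>2) *\<^sub>R R) *v z))"

definition gpf_run ::
  "('a::{real_inner,polish_space} \<Rightarrow> real^'k) \<Rightarrow> (real^'k \<Rightarrow> 'a) \<Rightarrow> real^'k^'k \<Rightarrow> real
   \<Rightarrow> real \<Rightarrow> real \<Rightarrow> real \<Rightarrow> ('a \<Rightarrow> 'a) \<Rightarrow> (nat \<Rightarrow> real^'k) \<Rightarrow> 'a \<Rightarrow> ('a \<Rightarrow> 'a)
   \<Rightarrow> (nat \<Rightarrow> 'a measure) \<Rightarrow> (nat \<Rightarrow> 'a) \<Rightarrow> (nat \<Rightarrow> 'a \<Rightarrow> 'a) \<Rightarrow> bool" where
  "gpf_run H Ha R \<epsilon> a r \<beta> F y m0 C0 G m C \<longleftrightarrow>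
     m 0 = m0 \<and> C 0 = C0 \<and>
     (\<forall>j\<ge>1.
        is_gaussian (G j) (m (j - 1)) (C (j - 1)) \<and>
        (let P = (\<lambda>x. Ha (H x));
             Fp = (\<lambda>u. F (projBV P \<beta> r u));
             mu = (\<integral>u. Fp u \<partial>G j);
             Sigma = (\<lambda>x. \<integral>u. ((Fp u - mu) \<bullet> x) *\<^sub>R (Fp u - mu) \<partial>G j);
             S = (\<lambda>x. Sigma x + a *\<^sub>R P x)
         in m j = mu + kgain H Ha \<epsilon> R S (y j - H mu) \<and>
            C j = (\<lambda>x. S x - kgain H Ha \<epsilon> R S (H (S x)))))"

end

theory Submission
  imports Defs
begin

text \<open>
  Both filters are compared with the truth \<open>u\<^sub>j\<close>; write \<open>Q = I - P\<close>. The surrogate agrees with \<open>\<Psi>\<close>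
  up to \<open>\<delta>\<close> after applying \<open>Q\<close>, and \<open>Q \<Psi>\<close> contracts the \<open>V\<close>-norm by \<open>s = sqrt \<alpha> < 1\<close>. Three
  quantities are propagated: the spread \<open>t\<^sub>j = (E V(u - m\<^sub>j)\<^sup>2)\<^sup>1\<^sup>/\<^sup>2\<close> for \<open>u \<sim> N(m\<^sub>j, C\<^sub>j)\<close>, and the two
  error components \<open>\<bar>Q(m\<^sub>j - u\<^sub>j)\<bar>\<close> and \<open>\<bar>H(m\<^sub>j - u\<^sub>j)\<bar>\<close>. The Joseph form of \<open>C\<^sub>j\<close> gives
  \<open>Q C\<^sub>j Q \<le> Q \<Sigma>\<^sub>j Q\<close> and \<open>H C\<^sub>j H\<^sup>* \<le> \<epsilon>\<^sup>2 R\<close>, so \<open>t\<^sub>j\<close> contracts with factor \<open>s\<close> up to \<open>O(\<epsilon> + \<delta>)\<close>.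
  The inflation \<open>a P\<close> bounds the inverse innovation covariance by \<open>1/a\<close>, which makes the observed
  error \<open>O(\<epsilon>)\<close>, while \<open>\<bar>Q \<Sigma>\<^sub>j H\<^sup>*\<bar> = O(\<delta> + t\<^sub>j)\<close> makes the correction in the unobserved directions
  small, although the observed part of the model error is only bounded by \<open>\<kappa>\<close>. A weighted sum of
  the three quantities therefore satisfies a linear recursion with factor below one and a forcing
  of order \<open>\<epsilon> + \<delta> + \<epsilon> \<bar>\<eta>\<^sub>j\<bar>\<close>.
\<close>

section \<open>Integration in a separable Hilbert space\<close>

text \<open>The sort \<open>{real_inner, polish_space}\<close> is not contained in \<open>banach\<close>, so the library's
  integrability criteria do not apply to Hilbert space valued functions.\<close>

lemma (in finite_measure) integrable_bounded_complete:
  fixes f :: "'a \<Rightarrow> 'b::{real_normed_vector, complete_space, second_countable_topology}"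
  assumes f[measurable]: "f \<in> borel_measurable M"
    and bd: "\<And>x. x \<in> space M \<Longrightarrow> norm (f x) \<le> B"
  shows "integrable M f"
proof -
  have f2: "f \<in> M \<rightarrow>\<^sub>M borel" by simp
  from borel_measurable_implies_sequence_metric[OF f, of 0] obtain s where
    s: "\<And>i. simple_function M (s i)" and
    lim: "\<And>x. x \<in> space M \<Longrightarrow> (\<lambda>i. s i x) \<longlonglongrightarrow> f x" and
    bound: "\<And>i x. x \<in> space M \<Longrightarrow> norm (s i x) \<le> 2 * norm (f x)"
    by simp metis
  have [measurable]: "s i \<in> borel_measurable M" for i
    using s by (rule borel_measurable_simple_function)
  have sB: "norm (s i x) \<le> 2 * B" if "x \<in> space M" for i x
    using bound[OF that, of i] bd[OF that] by simp
  have fin: "(\<integral>\<^sup>+x. ennreal (2 * B) \<partial>M) < \<infinity>"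
    by (simp add: emeasure_eq_measure ennreal_mult_less_top)
  have sb: "Bochner_Integration.simple_bochner_integrable M (s i)" for i
  proof (rule simple_bochner_integrableI_bounded)
    show "simple_function M (s i)" by (rule s)
    have "(\<integral>\<^sup>+x. norm (s i x) \<partial>M) \<le> (\<integral>\<^sup>+x. ennreal (2 * B) \<partial>M)"
      by (intro nn_integral_mono ennreal_leI sB)
    also note fin
    finally show "(\<integral>\<^sup>+x. norm (s i x) \<partial>M) < \<infinity>" .
  qed
  have conv: "(\<lambda>i. \<integral>\<^sup>+x. norm (f x - s i x) \<partial>M) \<longlonglongrightarrow> 0"
    by (rule nn_integral_dominated_convergence_norm[where w="\<lambda>_. 2 * B"])
       (use fin sB lim in auto)
  let ?I = "\<lambda>n. Bochner_Integration.simple_bochner_integral M (s n)"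
  \<comment> \<open>Convergence in L1 makes the integrals of the simple functions a Cauchy sequence;
    completeness of the space then yields the limit that the definition of a Bochner integral asks
    for.\<close>
  have "Cauchy ?I"
  proof (rule metric_CauchyI)
    fix e :: real assume e: "0 < e"
    then have "0 < ennreal (e / 2)" by simp
    from order_tendstoD(2)[OF conv this] obtain N where
      N: "\<And>n. N \<le> n \<Longrightarrow> (\<integral>\<^sup>+x. norm (f x - s n x) \<partial>M) < e / 2"
      by (auto simp: eventually_sequentially)
    have "dist (?I m) (?I n) < e" if "N \<le> m" "N \<le> n" for m n
    proof -
      have "ennreal (norm (?I m - ?I n)) < ennreal (e / 2) + ennreal (e / 2)"
        using simple_bochner_integral_bounded[OF f2 sb[of m] sb[of n]]
          add_strict_mono[OF N[OF that(1)] N[OF that(2)]] by (rule le_less_trans)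
      also have "\<dots> = ennreal e" using e by (simp flip: ennreal_plus)
      finally show ?thesis using e by (simp add: dist_norm ennreal_less_iff)
    qed
    then show "\<exists>N. \<forall>m\<ge>N. \<forall>n\<ge>N. dist (?I m) (?I n) < e" by blast
  qed
  then obtain x where "?I \<longlonglongrightarrow> x"
    unfolding Cauchy_convergent_iff convergent_def by blast
  then have "has_bochner_integral M f x"
    by (intro has_bochner_integral.intros[OF f2 sb conv])
  then show ?thesis by (rule integrable.intros)
qed

text \<open>Pairing the integral \<open>?v\<close> with itself turns the estimate into one between
  real integrals, by Cauchy-Schwarz; a nonzero \<open>norm ?v\<close> is then cancelled.\<close>

lemma norm_integral_le:
  fixes f :: "'a \<Rightarrow> 'b::{real_inner, second_countable_topology}"
  assumes f: "integrable M f" and g: "integrable M g"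
    and le: "\<And>x. x \<in> space M \<Longrightarrow> norm (f x) \<le> g x"
  shows "norm (\<integral>x. f x \<partial>M) \<le> (\<integral>x. g x \<partial>M)"
proof -
  let ?v = "\<integral>x. f x \<partial>M"
  have "norm ?v * norm ?v = (\<integral>x. ?v \<bullet> f x \<partial>M)"
    using f by (simp add: power2_norm_eq_inner flip: power2_eq_square)
  also have "\<dots> \<le> (\<integral>x. norm ?v * g x \<partial>M)"
  proof (intro integral_mono)
    show "?v \<bullet> f x \<le> norm ?v * g x" if "x \<in> space M" for x
      using norm_cauchy_schwarz[of ?v "f x"] mult_left_mono[OF le[OF that], of "norm ?v"] by simp
  qed (use f g in auto)
  also have "\<dots> = norm ?v * (\<integral>x. g x \<partial>M)" by simp
  finally show ?thesis
    using Bochner_Integration.integral_nonneg[of M g] order_trans[OF norm_ge_zero le]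
    by (cases "?v = 0") (auto simp: mult_le_cancel_left)
qed

text \<open>Nonnegativity of the variance. Second moments of \<open>V\<close> thereby control its
  first moments.\<close>

lemma (in prob_space) integral_le_sqrt_integral_square:
  fixes g :: "'a \<Rightarrow> real"
  assumes [measurable]: "g \<in> borel_measurable M" and sq: "integrable M (\<lambda>x. (g x)\<^sup>2)"
  shows "integrable M g" "(\<integral>x. g x \<partial>M) \<le> sqrt (\<integral>x. (g x)\<^sup>2 \<partial>M)"
proof -
  show g: "integrable M g"
    by (rule square_integrable_imp_integrable) (use sq in auto)
  show "(\<integral>x. g x \<partial>M) \<le> sqrt (\<integral>x. (g x)\<^sup>2 \<partial>M)"
    by (rule real_le_rsqrt) (use variance_eq[OF g sq] variance_positive[of g] in simp)
qed

section \<open>Second moments of Gaussian measures\<close>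

lemma nn_integral_normal_measure:
  assumes "v \<ge> 0"
  shows "(\<integral>\<^sup>+x. ennreal ((x - mu)\<^sup>2) \<partial>normal_measure mu v) = ennreal v"
proof (cases "v = 0")
  case True
  then show ?thesis by (simp add: normal_measure_def nn_integral_return)
next
  case False
  with assms have pos: "0 < sqrt v" by simp
  have hb: "has_bochner_integral lborel (\<lambda>x. normal_density mu (sqrt v) x * (x - mu)\<^sup>2) v"
    using normal_moment_even[OF pos, of mu 1] assms by (simp add: fact_numeral)
  have "(\<integral>\<^sup>+x. ennreal ((x - mu)\<^sup>2) \<partial>normal_measure mu v) =
      (\<integral>\<^sup>+x. ennreal (normal_density mu (sqrt v) x * (x - mu)\<^sup>2) \<partial>lborel)"
    using False by (simp add: normal_measure_def nn_integral_density ennreal_mult)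
  also have "\<dots> = ennreal v"
    using hb by (subst nn_integral_eq_integral) (auto simp: has_bochner_integral_iff)
  finally show ?thesis .
qed

text \<open>Only the laws of \<open>h \<bullet> u\<close> are prescribed by
  \<open>is_gaussian\<close>, so the covariance is recovered one direction at a time. The
  nonnegative integral is used because no integrability over the Hilbert space is known yet.\<close>

lemma is_gaussian_second_moment:
  assumes G: "is_gaussian M m C" and pos: "h \<bullet> C h \<ge> 0"
  shows "(\<integral>\<^sup>+u. ennreal ((h \<bullet> (u - m))\<^sup>2) \<partial>M) = ennreal (h \<bullet> C h)"
proof -
  have [measurable_cong]: "sets M = sets borel" using G by (simp add: is_gaussian_def)
  have "(\<integral>\<^sup>+u. ennreal ((h \<bullet> (u - m))\<^sup>2) \<partial>M) = (\<integral>\<^sup>+x. ennreal ((x - h \<bullet> m)\<^sup>2) \<partial>distr M borel (\<lambda>u. h \<bullet> u))"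
    by (subst nn_integral_distr) (auto simp: inner_diff_right)
  also have "\<dots> = ennreal (h \<bullet> C h)"
    using G pos by (simp add: is_gaussian_def nn_integral_normal_measure)
  finally show ?thesis .
qed

section \<open>Orthonormal sets and comparison of traces\<close>

lemma finite_orthonormal_span:
  fixes D :: "'a::real_inner set"
  assumes "finite D"
  obtains B where "finite B" "D \<subseteq> span B" "\<And>b. b \<in> B \<Longrightarrow> b \<bullet> b = 1"
    "\<And>b c. b \<in> B \<Longrightarrow> c \<in> B \<Longrightarrow> b \<noteq> c \<Longrightarrow> b \<bullet> c = 0"
proof -
  have "\<exists>B. finite B \<and> D \<subseteq> span B \<and> (\<forall>b\<in>B. b \<bullet> b = 1) \<and> (\<forall>b\<in>B. \<forall>c\<in>B. b \<noteq> c \<longrightarrow> b \<bullet> c = 0)"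
    using assms
  proof induction
    case empty
    then show ?case by (intro exI[of _ "{}"]) auto
  next
    case (insert d D)
    from insert.IH obtain B where
      "finite B \<and> D \<subseteq> span B \<and> (\<forall>b\<in>B. b \<bullet> b = 1) \<and> (\<forall>b\<in>B. \<forall>c\<in>B. b \<noteq> c \<longrightarrow> b \<bullet> c = 0)" ..
    then have B: "finite B" "D \<subseteq> span B" "\<forall>b\<in>B. b \<bullet> b = 1"
      "\<forall>b\<in>B. \<forall>c\<in>B. b \<noteq> c \<longrightarrow> b \<bullet> c = 0"
      by simp_all
    \<comment> \<open>Gram-Schmidt: if this residual vanishes, \<open>B\<close> already spans
      \<open>d\<close>; otherwise its normalization joins \<open>B\<close>.\<close>
    define z where "z = d - (\<Sum>b\<in>B. (b \<bullet> d) *\<^sub>R b)"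
    have zo: "c \<bullet> z = 0" if "c \<in> B" for c
    proof -
      have cb: "c \<bullet> b = (if b = c then 1 else 0)" if "b \<in> B" for b
        using bspec[OF B(3) that] bspec[OF bspec[OF B(4) \<open>c \<in> B\<close>] that] by auto
      have "(\<Sum>b\<in>B. (b \<bullet> d) * (c \<bullet> b)) = (\<Sum>b\<in>B. if b = c then c \<bullet> d else 0)"
        by (intro sum.cong refl) (simp add: cb)
      then show ?thesis using that B(1) by (simp add: z_def inner_diff_right inner_sum_right)
    qed
    have sumB: "(\<Sum>b\<in>B. (b \<bullet> d) *\<^sub>R b) \<in> span B"
      by (intro span_sum span_scale span_base)
    show ?case
    proof (cases "z = 0")
      case True
      then have "d \<in> span B" using sumB by (simp add: z_def)
      then show ?thesis using B by (intro exI[of _ B]) auto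
    next
      case False
      define e where "e = z /\<^sub>R norm z"
      have ee: "e \<bullet> e = 1" using False
        by (simp add: e_def field_simps flip: power2_norm_eq_inner power2_eq_square)
      have ce: "c \<bullet> e = 0" if "c \<in> B" for c using zo[OF that] by (simp add: e_def)
      have "z = norm z *\<^sub>R e" using False by (simp add: e_def)
      then have "d = norm z *\<^sub>R e + (\<Sum>b\<in>B. (b \<bullet> d) *\<^sub>R b)" by (simp add: z_def)
      moreover have "norm z *\<^sub>R e \<in> span (insert e B)"
        by (intro span_scale span_base) simp
      moreover have "(\<Sum>b\<in>B. (b \<bullet> d) *\<^sub>R b) \<in> span (insert e B)"
        using sumB span_mono[of B "insert e B"] by blast
      ultimately have "d \<in> span (insert e B)" by (metis span_add)
      then have "insert d D \<subseteq> span (insert e B)"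
        using B(2) span_mono[of B "insert e B"] by blast
      then show ?thesis using B ee ce
        by (intro exI[of _ "insert e B"]) (auto simp: inner_commute)
    qed
  qed
  then obtain B where
    "finite B \<and> D \<subseteq> span B \<and> (\<forall>b\<in>B. b \<bullet> b = 1) \<and> (\<forall>b\<in>B. \<forall>c\<in>B. b \<noteq> c \<longrightarrow> b \<bullet> c = 0)" ..
  then show ?thesis by (intro that[of B]) simp_all
qed

text \<open>The residual is orthogonal to \<open>span B\<close>, which yields both the norm identity
  and the best approximation.\<close>

lemma orthonormal_pythagoras:
  fixes B :: "'a::real_inner set"
  assumes B: "finite B" "\<And>b. b \<in> B \<Longrightarrow> b \<bullet> b = 1"
    "\<And>b c. b \<in> B \<Longrightarrow> c \<in> B \<Longrightarrow> b \<noteq> c \<Longrightarrow> b \<bullet> c = 0"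
  shows "(norm x)\<^sup>2 = (\<Sum>b\<in>B. (b \<bullet> x)\<^sup>2) + (norm (x - (\<Sum>b\<in>B. (b \<bullet> x) *\<^sub>R b)))\<^sup>2"
    and "d \<in> span B \<Longrightarrow> norm (x - (\<Sum>b\<in>B. (b \<bullet> x) *\<^sub>R b)) \<le> norm (x - d)"
proof -
  define p where "p = (\<Sum>b\<in>B. (b \<bullet> x) *\<^sub>R b)"
  have o: "c \<bullet> (x - p) = 0" if "c \<in> B" for c
  proof -
    have cb: "c \<bullet> b = (if b = c then 1 else 0)" if "b \<in> B" for b
      using B(2,3) \<open>c \<in> B\<close> that by simp
    have "(\<Sum>b\<in>B. (b \<bullet> x) * (c \<bullet> b)) = (\<Sum>b\<in>B. if b = c then c \<bullet> x else 0)"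
      by (intro sum.cong refl) (simp add: cb)
    then show ?thesis using that B(1) by (simp add: p_def inner_diff_right inner_sum_right)
  qed
  have os: "c \<bullet> (x - p) = 0" if "c \<in> span B" for c
    using that
    by (induction rule: span_induct_alt) (auto simp: inner_add_left o)
  have pspan: "p \<in> span B" unfolding p_def by (intro span_sum span_scale span_base)
  have pyth: "(norm (q + (x - p)))\<^sup>2 = (norm q)\<^sup>2 + (norm (x - p))\<^sup>2" if "q \<in> span B" for q
    using os[OF that] by (simp add: power2_norm_eq_inner inner_add_left inner_add_right inner_commute)
  have "p \<bullet> p = p \<bullet> x" using os[OF pspan] by (simp add: inner_diff_right)
  also have "\<dots> = (\<Sum>b\<in>B. (b \<bullet> x)\<^sup>2)"
    by (simp add: p_def inner_sum_left power2_eq_square)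
  finally show "(norm x)\<^sup>2 = (\<Sum>b\<in>B. (b \<bullet> x)\<^sup>2) + (norm (x - (\<Sum>b\<in>B. (b \<bullet> x) *\<^sub>R b)))\<^sup>2"
    using pyth[OF pspan] by (simp add: power2_norm_eq_inner flip: p_def)
  assume "d \<in> span B"
  then have "(norm (x - d))\<^sup>2 = (norm (p - d))\<^sup>2 + (norm (x - p))\<^sup>2"
    using pyth[of "p - d"] pspan by (simp add: span_diff)
  then have "(norm (x - p))\<^sup>2 \<le> (norm (x - d))\<^sup>2" by simp
  then show "norm (x - (\<Sum>b\<in>B. (b \<bullet> x) *\<^sub>R b)) \<le> norm (x - d)"
    unfolding p_def by (rule power2_le_imp_le) simp
qed

text \<open>Monotonicity of the trace, without an orthonormal basis: finite orthonormal sets whose spans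
  exhaust a countable dense set suffice, by Fatou's lemma.\<close>

lemma nn_integral_norm_square_mono:
  fixes f :: "'b \<Rightarrow> 'a::{real_inner, second_countable_topology}" and g :: "'c \<Rightarrow> 'a"
  assumes [measurable]: "f \<in> borel_measurable M" "g \<in> borel_measurable N"
    and le: "\<And>h. (\<integral>\<^sup>+x. ennreal ((h \<bullet> f x)\<^sup>2) \<partial>M) \<le> (\<integral>\<^sup>+x. ennreal ((h \<bullet> g x)\<^sup>2) \<partial>N)"
  shows "(\<integral>\<^sup>+x. ennreal ((norm (f x))\<^sup>2) \<partial>M) \<le> (\<integral>\<^sup>+x. ennreal ((norm (g x))\<^sup>2) \<partial>N)"
proof -
  obtain D :: "'a set" where "countable D" and dense: "\<And>X. open X \<Longrightarrow> X \<noteq> {} \<Longrightarrow> \<exists>d\<in>D. d \<in> X"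
    by (erule countable_dense_setE)
  then have "D \<noteq> {}" using dense[of UNIV] by auto
  define d where "d = from_nat_into D"
  have rd: "range d = D" unfolding d_def by (rule range_from_nat_into) fact+
  have "\<exists>B. finite B \<and> d ` {..n} \<subseteq> span B \<and> (\<forall>b\<in>B. b \<bullet> b = 1) \<and>
      (\<forall>b\<in>B. \<forall>c\<in>B. b \<noteq> c \<longrightarrow> b \<bullet> c = 0)" for n :: nat
    by (rule finite_orthonormal_span[of "d ` {..n}"]) auto
  then obtain B where B: "\<And>n. finite (B n)" "\<And>n::nat. d ` {..n} \<subseteq> span (B n)"
    "\<And>n b. b \<in> B n \<Longrightarrow> b \<bullet> b = 1"
    "\<And>n b c. b \<in> B n \<Longrightarrow> c \<in> B n \<Longrightarrow> b \<noteq> c \<Longrightarrow> b \<bullet> c = 0" by metis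
  let ?S = "\<lambda>n x. \<Sum>b\<in>B n. (b \<bullet> x)\<^sup>2"
  have pyth: "(norm x)\<^sup>2 = ?S n x + (norm (x - (\<Sum>b\<in>B n. (b \<bullet> x) *\<^sub>R b)))\<^sup>2" for n x
    by (intro orthonormal_pythagoras(1)[of "B n"]) (use B in auto)
  \<comment> \<open>The residual \<open>?r n\<close> is at most the distance from \<open>x\<close>
    to any of the dense points \<open>d 0\<close>, ..., \<open>d n\<close>, hence tends to
    zero.\<close>
  have lim: "(\<lambda>n. ?S n x) \<longlonglongrightarrow> (norm x)\<^sup>2" for x
  proof -
    let ?r = "\<lambda>n. norm (x - (\<Sum>b\<in>B n. (b \<bullet> x) *\<^sub>R b))"
    have "?r \<longlonglongrightarrow> 0"
    proof (rule LIMSEQ_I)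
      fix e :: real assume "0 < e"
      then obtain z where "z \<in> D" "z \<in> ball x e" using dense[of "ball x e"] by auto
      then obtain k where k: "d k \<in> ball x e" using rd by blast
      have "norm (?r n - 0) < e" if "n \<ge> k" for n
      proof -
        have "d k \<in> span (B n)" using B(2)[of n] that by blast
        then have "?r n \<le> norm (x - d k)"
          by (intro orthonormal_pythagoras(2)[of "B n"]) (use B in auto)
        then show ?thesis using k by (simp add: dist_norm)
      qed
      then show "\<exists>no. \<forall>n\<ge>no. norm (?r n - 0) < e" by blast
    qed
    then have "(\<lambda>n. (norm x)\<^sup>2 - (?r n)\<^sup>2) \<longlonglongrightarrow> (norm x)\<^sup>2 - 0\<^sup>2"
      by (intro tendsto_intros)
    moreover have "(norm x)\<^sup>2 - (?r n)\<^sup>2 = ?S n x" for n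
      using pyth[of x n] by simp
    ultimately show ?thesis by simp
  qed
  have Sle: "?S n x \<le> (norm x)\<^sup>2" for n x
    using pyth[of x n] by simp
  have fin: "(\<integral>\<^sup>+x. ennreal (?S n (f x)) \<partial>M) \<le> (\<integral>\<^sup>+x. ennreal ((norm (g x))\<^sup>2) \<partial>N)" for n
  proof -
    have "(\<integral>\<^sup>+x. ennreal (?S n (f x)) \<partial>M) = (\<Sum>b\<in>B n. \<integral>\<^sup>+x. ennreal ((b \<bullet> f x)\<^sup>2) \<partial>M)"
      by (simp add: nn_integral_sum flip: sum_ennreal)
    also have "\<dots> \<le> (\<Sum>b\<in>B n. \<integral>\<^sup>+x. ennreal ((b \<bullet> g x)\<^sup>2) \<partial>N)"
      by (intro sum_mono le)
    also have "\<dots> = (\<integral>\<^sup>+x. ennreal (?S n (g x)) \<partial>N)"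
      by (simp add: nn_integral_sum flip: sum_ennreal)
    also have "\<dots> \<le> (\<integral>\<^sup>+x. ennreal ((norm (g x))\<^sup>2) \<partial>N)"
      by (intro nn_integral_mono ennreal_leI Sle)
    finally show ?thesis .
  qed
  \<comment> \<open>The sets \<open>B n\<close> are chosen independently of each other, so
    \<open>?S\<close> is not known to increase in \<open>n\<close>; Fatou's lemma passes to the
    limit with the uniform bound \<open>fin\<close>.\<close>
  have "(\<integral>\<^sup>+x. ennreal ((norm (f x))\<^sup>2) \<partial>M) = (\<integral>\<^sup>+x. liminf (\<lambda>n. ennreal (?S n (f x))) \<partial>M)"
    by (intro nn_integral_cong lim_imp_Liminf[symmetric] tendsto_ennrealI lim) simp
  also have "\<dots> \<le> liminf (\<lambda>n. \<integral>\<^sup>+x. ennreal (?S n (f x)) \<partial>M)"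
    by (intro nn_integral_liminf) simp
  also have "\<dots> \<le> liminf (\<lambda>n. \<integral>\<^sup>+x. ennreal ((norm (g x))\<^sup>2) \<partial>N)"
    by (intro Liminf_mono always_eventually allI fin)
  also have "\<dots> = (\<integral>\<^sup>+x. ennreal ((norm (g x))\<^sup>2) \<partial>N)"
    by (simp add: Liminf_const)
  finally show ?thesis .
qed

text \<open>Nothing is known about the measurability of \<open>W k\<close>. It is therefore
  dominated pointwise by the solution \<open>B\<close> of the recursion with equality, a combination
  of the integrable \<open>g k\<close>, and monotonicity of the nonnegative integral transfers the
  bound.\<close>

lemma limsup_expectation_contractive_recursion:
  fixes W g :: "nat \<Rightarrow> 'a \<Rightarrow> real"
  assumes s: "0 \<le> s" "s < 1" and nonneg: "0 \<le> c0" "0 \<le> c" "0 \<le> d"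
    and g: "\<And>k. integrable M (g k)" "\<And>k. (\<integral>x. g k x \<partial>M) \<le> K" "\<And>k x. x \<in> space M \<Longrightarrow> 0 \<le> g k x"
    and M: "prob_space M"
    and W0: "\<And>x. x \<in> space M \<Longrightarrow> W 0 x \<le> c0 + d * g 0 x"
    and W: "\<And>k x. x \<in> space M \<Longrightarrow> W (Suc k) x \<le> s * W k x + (c + d * g (Suc k) x)"
  shows "limsup (\<lambda>k. \<integral>\<^sup>+x. ennreal (W k x) \<partial>M) \<le> ennreal ((c + d * K) / (1 - s))"
proof -
  interpret prob_space M by fact
  define B where "B = rec_nat (\<lambda>x. c0 + d * g 0 x) (\<lambda>k b x. s * b x + (c + d * g (Suc k) x))"
  have B0: "B 0 = (\<lambda>x. c0 + d * g 0 x)"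
    and BS: "B (Suc k) = (\<lambda>x. s * B k x + (c + d * g (Suc k) x))" for k
    by (auto simp: B_def)
  have int: "integrable M (B k)" for k
    by (induction k) (use g in \<open>auto simp: B0 BS\<close>)
  have B_nonneg: "0 \<le> B k x" if "x \<in> space M" for k x
    by (induction k) (use g that s nonneg in \<open>auto simp: B0 BS\<close>)
  have WB: "W k x \<le> B k x" if "x \<in> space M" for k x
  proof (induction k)
    case (Suc k)
    then show ?case
      using W[OF that, of k] mult_left_mono[OF Suc s(1)] by (simp add: BS)
  qed (use W0 that in \<open>simp add: B0\<close>)
  \<comment> \<open>The fixed point of the averaged recursion; the excess over it shrinks by the
    factor \<open>s\<close> in each step and disappears in the limit.\<close>
  define L where "L = (c + d * K) / (1 - s)"
  have L: "s * L + (c + d * K) = L" using s by (simp add: L_def field_simps)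
  have EB: "(\<integral>x. B k x \<partial>M) \<le> s ^ k * (c0 + d * K) + L" for k
  proof (induction k)
    case 0
    have "0 \<le> K" using g(2)[of 0] Bochner_Integration.integral_nonneg[of M "g 0"] g(3)
      by (meson order_trans)
    then have "0 \<le> L" using s nonneg by (simp add: L_def)
    then show ?case
      using mult_left_mono[OF g(2)[of 0] nonneg(3)] g(1) by (simp add: B0 prob_space)
  next
    case (Suc k)
    have "(\<integral>x. B (Suc k) x \<partial>M) = s * (\<integral>x. B k x \<partial>M) + (c + d * (\<integral>x. g (Suc k) x \<partial>M))"
      using g(1) int by (simp add: BS prob_space)
    also have "\<dots> \<le> s * (s ^ k * (c0 + d * K) + L) + (c + d * K)"
      using Suc s nonneg g(2) by (intro add_mono mult_left_mono) auto
    also have "\<dots> = s ^ Suc k * (c0 + d * K) + L"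
      using L by (simp add: algebra_simps)
    finally show ?case .
  qed
  have "(\<lambda>k. ennreal (s ^ k * (c0 + d * K) + L)) \<longlonglongrightarrow> ennreal (0 * (c0 + d * K) + L)"
    using s by (intro tendsto_ennrealI tendsto_intros LIMSEQ_realpow_zero) auto
  then have lim: "limsup (\<lambda>k. ennreal (s ^ k * (c0 + d * K) + L)) = ennreal L"
    by (simp add: lim_imp_Limsup)
  have "(\<integral>\<^sup>+x. ennreal (W k x) \<partial>M) \<le> ennreal (s ^ k * (c0 + d * K) + L)" for k
  proof -
    have "(\<integral>\<^sup>+x. ennreal (W k x) \<partial>M) \<le> (\<integral>\<^sup>+x. ennreal (B k x) \<partial>M)"
      by (intro nn_integral_mono ennreal_leI WB)
    also have "\<dots> = ennreal (\<integral>x. B k x \<partial>M)"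
      by (intro nn_integral_eq_integral int AE_I2 B_nonneg)
    also have "\<dots> \<le> ennreal (s ^ k * (c0 + d * K) + L)"
      by (intro ennreal_leI EB)
    finally show ?thesis .
  qed
  then have "limsup (\<lambda>k. \<integral>\<^sup>+x. ennreal (W k x) \<partial>M) \<le> limsup (\<lambda>k. ennreal (s ^ k * (c0 + d * K) + L))"
    by (intro Limsup_mono always_eventually allI)
  also note lim
  finally show ?thesis by (simp add: L_def)
qed

section \<open>The weighted norm and its projection onto the ball\<close>

locale weighted_coisometry =
  fixes H :: "'a::real_inner \<Rightarrow> real^'k" and Ha :: "real^'k \<Rightarrow> 'a" and \<beta> :: real
  assumes bounded_linear_H: "bounded_linear H"
    and adjoint: "\<And>u z. Ha z \<bullet> u = z \<bullet> H u"
    and coisometry: "\<And>z. H (Ha z) = z"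
    and \<beta>_nonneg: "\<beta> \<ge> 0"
begin

abbreviation P where "P \<equiv> (\<lambda>x. Ha (H x))"
abbreviation Q where "Q x \<equiv> x - Ha (H x)"
abbreviation V where "V \<equiv> Vnorm P \<beta>"

text \<open>The inner product that induces the norm \<open>V\<close>; since \<open>Ha\<close> is an
  isometry, \<open>H\<close> can stand in for \<open>P\<close>.\<close>

definition Vip where "Vip x y = x \<bullet> y + \<beta> * (H x \<bullet> H y)"

lemma adjoint': "u \<bullet> Ha z = H u \<bullet> z"
  using adjoint[of z u] by (simp add: inner_commute)

lemma linear_H: "linear H"
  using bounded_linear_H by (rule bounded_linear.linear)

lemmas H_simps = linear_add[OF linear_H] linear_diff[OF linear_H] linear_cmul[OF linear_H]
  linear_0[OF linear_H] linear_neg[OF linear_H]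

lemma norm_Ha: "norm (Ha z) = norm z"
  by (simp add: norm_eq_sqrt_inner adjoint coisometry)

text \<open>A vector is determined by its inner products, and the adjoint relation makes those of
  \<open>Ha z\<close> linear in \<open>z\<close>.\<close>

lemma linear_Ha: "linear Ha"
proof -
  have ext: "x = y" if "\<And>u. x \<bullet> u = y \<bullet> u" for x y :: 'a
    using that[of "x - y"] by (metis inner_eq_zero_iff inner_diff_left right_minus_eq)
  show ?thesis
    by (rule linearI; rule ext) (simp_all add: adjoint inner_add_left)
qed

lemmas Ha_simps = linear_add[OF linear_Ha] linear_diff[OF linear_Ha] linear_cmul[OF linear_Ha]
  linear_0[OF linear_Ha] linear_neg[OF linear_Ha]

lemma bounded_linear_Ha: "bounded_linear Ha"
  using linear_Ha by (intro bounded_linear.intro bounded_linear_axioms.intro exI[of _ 1])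
    (simp_all add: norm_Ha)

lemma bounded_linear_Q: "bounded_linear (\<lambda>x. Q x)"
  by (intro bounded_linear_sub bounded_linear_ident
      bounded_linear_compose[OF bounded_linear_Ha bounded_linear_H])

lemma H_Q: "H (Q x) = 0"
  by (simp add: H_simps coisometry)

lemma norm_square_split: "(norm x)\<^sup>2 = (norm (Q x))\<^sup>2 + (norm (H x))\<^sup>2"
  by (simp add: power2_norm_eq_inner inner_diff_left inner_diff_right adjoint adjoint' coisometry H_simps)

lemma norm_H_le: "norm (H x) \<le> norm x"
  by (rule power2_le_imp_le) (use norm_square_split[of x] in auto)

lemma norm_Q_le: "norm (Q x) \<le> norm x"
  by (rule power2_le_imp_le) (use norm_square_split[of x] in auto)

lemma norm_le_Q_H: "norm x \<le> norm (Q x) + norm (H x)"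
  using norm_triangle_ineq[of "Q x" "Ha (H x)"] by (simp add: norm_Ha)

lemma Vnorm_square: "(V x)\<^sup>2 = (norm (Q x))\<^sup>2 + (1 + \<beta>) * (norm (H x))\<^sup>2"
  using \<beta>_nonneg norm_square_split[of x]
  by (simp add: Vnorm_def norm_Ha algebra_simps add_nonneg_nonneg)

lemma Vnorm_square_Vip: "(V x)\<^sup>2 = Vip x x"
  using \<beta>_nonneg by (simp add: Vnorm_def norm_Ha Vip_def power2_norm_eq_inner add_nonneg_nonneg)

lemma Vnorm_nonneg: "0 \<le> V x"
  using \<beta>_nonneg by (simp add: Vnorm_def)

lemma norm_le_Vnorm: "norm x \<le> V x"
  by (rule power2_le_imp_le)
     (use \<beta>_nonneg Vnorm_nonneg in \<open>simp_all add: Vnorm_def norm_Ha\<close>)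

lemma Vnorm_le_norm: "V x \<le> sqrt (1 + \<beta>) * norm x"
proof (rule power2_le_imp_le)
  show "(V x)\<^sup>2 \<le> (sqrt (1 + \<beta>) * norm x)\<^sup>2"
    using \<beta>_nonneg norm_square_split[of x] by (simp add: Vnorm_square power_mult_distrib algebra_simps)
qed (use \<beta>_nonneg in simp)

lemma Vnorm_le_Q_H: "V x \<le> norm (Q x) + sqrt (1 + \<beta>) * norm (H x)"
  by (rule power2_le_imp_le)
     (use \<beta>_nonneg in \<open>simp_all add: Vnorm_square power2_sum power_mult_distrib\<close>)

text \<open>\<open>V x\<close> is the norm of \<open>(x, sqrt \<beta> *\<^sub>R H x)\<close> in a
  product space, whose triangle inequality is inherited.\<close>

lemma Vnorm_triangle: "V (x + y) \<le> V x + V y"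
proof -
  have V: "V z = norm (z, sqrt \<beta> *\<^sub>R H z)" for z
    using \<beta>_nonneg by (simp add: Vnorm_def norm_Pair norm_Ha power_mult_distrib)
  show ?thesis
    using norm_triangle_ineq[of "(x, sqrt \<beta> *\<^sub>R H x)" "(y, sqrt \<beta> *\<^sub>R H y)"]
    by (simp add: V H_simps scaleR_add_right)
qed

lemma Vip_simps:
  "Vip (x - y) z = Vip x z - Vip y z" "Vip z (x - y) = Vip z x - Vip z y" "Vip x y = Vip y x"
  by (simp_all add: Vip_def inner_diff_left inner_diff_right H_simps algebra_simps inner_commute)

text \<open>\<open>projBV\<close> is a definite description, so a candidate must be both minimal and
  unique. Expanding the square, the variational inequality improves minimality by the square of
  \<open>V (v - w)\<close>, and this surplus gives uniqueness.\<close>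

lemma projBV_eqI:
  assumes v: "norm v \<le> r" and var: "\<And>w. norm w \<le> r \<Longrightarrow> Vip (u - v) (w - v) \<le> 0"
  shows "projBV P \<beta> r u = v"
proof -
  have key: "(V (u - v))\<^sup>2 + (V (v - w))\<^sup>2 \<le> (V (u - w))\<^sup>2" if "norm w \<le> r" for w
    using var[OF that] unfolding Vnorm_square_Vip
    by (simp add: Vip_simps)
  show ?thesis unfolding projBV_def
  proof (rule the_equality)
    have "V (u - v) \<le> V (u - w)" if "norm w \<le> r" for w
    proof (rule power2_le_imp_le)
      show "(V (u - v))\<^sup>2 \<le> (V (u - w))\<^sup>2"
        using key[OF that] zero_le_power2[of "V (v - w)"] by linarith
    qed (rule Vnorm_nonneg)
    with v show "norm v \<le> r \<and> (\<forall>w. norm w \<le> r \<longrightarrow> V (u - v) \<le> V (u - w))" by blast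
  next
    fix z assume z: "norm z \<le> r \<and> (\<forall>w. norm w \<le> r \<longrightarrow> V (u - z) \<le> V (u - w))"
    then have "V (u - z) \<le> V (u - v)" using v by blast
    then have "(V (u - z))\<^sup>2 \<le> (V (u - v))\<^sup>2" by (rule power_mono) (rule Vnorm_nonneg)
    moreover have "(V (u - v))\<^sup>2 + (V (v - z))\<^sup>2 \<le> (V (u - z))\<^sup>2"
      using key[of z] z by blast
    ultimately have "(V (v - z))\<^sup>2 \<le> 0" by linarith
    then have "V (v - z) = 0" by simp
    then show "z = v" using norm_le_Vnorm[of "v - z"] by simp
  qed
qed

text \<open>In the nontrivial case the projection is found explicitly from the Lagrange multiplier
  \<open>l\<close> of the constraint \<open>norm v = r\<close>, which the intermediate value theorem supplies.\<close>

lemma projBV_variational: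
  assumes r: "r > 0"
  shows "norm (projBV P \<beta> r u) \<le> r"
    and "norm w \<le> r \<Longrightarrow> Vip (u - projBV P \<beta> r u) (w - projBV P \<beta> r u) \<le> 0"
proof -
  have "\<exists>v. norm v \<le> r \<and> (\<forall>w. norm w \<le> r \<longrightarrow> Vip (u - v) (w - v) \<le> 0)"
  proof (cases "norm u \<le> r")
    case True
    then show ?thesis by (intro exI[of _ u]) (simp add: Vip_def H_simps)
  next
    case False
    \<comment> \<open>Stationarity of the Lagrangian reads
      \<open>(I + \<beta> P) (u - v) = l v\<close>. It decouples over the ranges of \<open>Q\<close>
      and \<open>P\<close>, which gives the two coefficients.\<close>
    define v where "v l = (1 / (1 + l)) *\<^sub>R Q u + ((1 + \<beta>) / (1 + \<beta> + l)) *\<^sub>R Ha (H u)" for l :: real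
    \<comment> \<open>Chosen so that \<open>norm (v l) \<le> c / (1 + l)\<close>. At
      \<open>l = c / r\<close> the norm is thus at most \<open>r\<close>, while
      \<open>v 0 = u\<close> lies outside the ball: a bracket for the intermediate value
      theorem.\<close>
    define c where "c = norm (Q u) + (1 + \<beta>) * norm (H u)"
    have c0: "0 \<le> c" using \<beta>_nonneg by (simp add: c_def)
    have "norm (v (c / r)) \<le> r"
    proof -
      define l where "l = c / r"
      have l: "l \<ge> 0" using c0 r by (simp add: l_def)
      have "norm (v l) \<le> norm (Q u) / (1 + l) + (1 + \<beta>) * norm (H u) / (1 + \<beta> + l)"
        using norm_triangle_ineq[of "(1 / (1 + l)) *\<^sub>R Q u" "((1 + \<beta>) / (1 + \<beta> + l)) *\<^sub>R Ha (H u)"] l \<beta>_nonneg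
        by (simp add: v_def norm_Ha)
      also have "\<dots> \<le> norm (Q u) / (1 + l) + (1 + \<beta>) * norm (H u) / (1 + l)"
        using l \<beta>_nonneg by (intro add_left_mono divide_left_mono) auto
      also have "\<dots> = c / (1 + l)" by (simp add: c_def add_divide_distrib)
      also have "\<dots> \<le> r" using c0 r l by (simp add: field_simps l_def)
      finally show ?thesis by (simp add: l_def)
    qed
    moreover have "r \<le> norm (v 0)" using False \<beta>_nonneg by (simp add: v_def)
    moreover have "0 \<le> c / r" using c0 r by simp
    moreover have "continuous_on {0..c / r} (\<lambda>l. norm (v l))"
      unfolding v_def using \<beta>_nonneg by (intro continuous_intros) auto
    ultimately obtain l where l: "0 \<le> l" "norm (v l) = r"
      using IVT2'[of "\<lambda>l. norm (v l)" "c / r" r 0] by auto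
    have Hv: "H (v l) = ((1 + \<beta>) / (1 + \<beta> + l)) *\<^sub>R H u"
      by (simp add: v_def H_simps coisometry)
    \<comment> \<open>The weak form of the stationarity equation. As \<open>l\<close> is
      nonnegative, the variational inequality reduces to Cauchy-Schwarz on the sphere of radius
      \<open>r\<close>.\<close>
    have "Vip (u - v l) x = l * (v l \<bullet> x)" for x
    proof -
      define p where "p = H u \<bullet> H x"
      define q where "q = u \<bullet> x - p"
      have vx: "v l \<bullet> x = q / (1 + l) + (1 + \<beta>) / (1 + \<beta> + l) * p"
        by (simp add: v_def inner_add_left inner_diff_left adjoint p_def q_def)
      have "Vip (u - v l) x = q + p - v l \<bullet> x + \<beta> * (p - (1 + \<beta>) / (1 + \<beta> + l) * p)"
        by (simp add: Vip_def inner_diff_left H_simps Hv p_def q_def)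
      also have "\<dots> = l * (v l \<bullet> x)"
        unfolding vx using l(1) \<beta>_nonneg by (simp add: divide_simps) (simp add: algebra_simps)
      finally show ?thesis .
    qed
    moreover have "v l \<bullet> (w - v l) \<le> 0" if "norm w \<le> r" for w
    proof -
      have "v l \<bullet> w \<le> r * norm w" using norm_cauchy_schwarz[of "v l" w] l(2) by simp
      also have "\<dots> \<le> r * r" by (rule mult_left_mono) (use that r in auto)
      also have "\<dots> = v l \<bullet> v l" using l(2) by (simp add: dot_square_norm power2_eq_square)
      finally show ?thesis by (simp add: inner_diff_right)
    qed
    ultimately show ?thesis using l by (intro exI[of _ "v l"]) (simp add: mult_nonneg_nonpos)
  qed
  then obtain v where v: "norm v \<le> r" "\<And>w. norm w \<le> r \<Longrightarrow> Vip (u - v) (w - v) \<le> 0" by blast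
  from projBV_eqI[OF this] v show "norm (projBV P \<beta> r u) \<le> r"
    and "norm w \<le> r \<Longrightarrow> Vip (u - projBV P \<beta> r u) (w - projBV P \<beta> r u) \<le> 0" by auto
qed

lemma projBV_id: "norm u \<le> r \<Longrightarrow> projBV P \<beta> r u = u"
  by (rule projBV_eqI) (simp_all add: Vip_def H_simps)

text \<open>Each variational inequality is tested with the other projection; their sum, combined
  with the nonnegative square of \<open>V ((u - u') - (?v - ?v'))\<close>, gives the claim.\<close>

lemma projBV_nonexpansive:
  assumes r: "r > 0"
  shows "V (projBV P \<beta> r u - projBV P \<beta> r u') \<le> V (u - u')"
proof (rule power2_le_imp_le)
  let ?v = "projBV P \<beta> r u" and ?v' = "projBV P \<beta> r u'"
  have "Vip (u - ?v) (?v' - ?v) \<le> 0" "Vip (u' - ?v') (?v - ?v') \<le> 0"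
    using projBV_variational[OF r] by auto
  moreover have "0 \<le> (V ((u - u') - (?v - ?v')))\<^sup>2" by simp
  ultimately show "(V (?v - ?v'))\<^sup>2 \<le> (V (u - u'))\<^sup>2"
    unfolding Vnorm_square_Vip
    by (simp add: Vip_simps)
qed (rule Vnorm_nonneg)

end

section \<open>The Kalman update\<close>

text \<open>\<open>S\<close> is the inflated forecast covariance. The inflation enters through
  \<open>S_coercive\<close>, which makes the innovation covariance invertible even where
  \<open>R\<close> is singular.\<close>

locale kalman_update = weighted_coisometry H Ha \<beta>
  for H :: "'a::real_inner \<Rightarrow> real^'k" and Ha :: "real^'k \<Rightarrow> 'a" and \<beta> :: real +
  fixes S :: "'a \<Rightarrow> 'a" and R :: "real^'k^'k" and \<epsilon> a :: real
  assumes linear_S: "linear S"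
    and S_symmetric: "\<And>x y. S x \<bullet> y = x \<bullet> S y"
    and S_nonneg: "\<And>x. 0 \<le> x \<bullet> S x"
    and S_coercive: "\<And>z. a * (norm z)\<^sup>2 \<le> z \<bullet> H (S (Ha z))"
    and R_symmetric: "\<And>x y. x \<bullet> (R *v y) = y \<bullet> (R *v x)"
    and R_nonneg: "\<And>x. 0 \<le> x \<bullet> (R *v x)"
    and a_pos: "0 < a" and \<epsilon>_pos: "0 < \<epsilon>"
begin

abbreviation A where "A z \<equiv> H (S (Ha z))"
definition innov where "innov = matrix (\<lambda>w. H (S (Ha w))) + \<epsilon>\<^sup>2 *\<^sub>R R"
abbreviation gain where "gain \<equiv> kgain H Ha \<epsilon> R S"
abbreviation posterior where "posterior x \<equiv> S x - gain (H (S x))"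

lemma innov_mult: "innov *v z = A z + \<epsilon>\<^sup>2 *\<^sub>R (R *v z)"
proof -
  have "linear (\<lambda>w. H (S (Ha w)))"
    using linear_compose[OF linear_compose[OF linear_Ha linear_S] linear_H] by (simp add: o_def)
  then show ?thesis
    by (simp add: innov_def matrix_vector_mult_add_rdistrib matrix_works scaleR_matrix_vector_assoc)
qed

lemma innov_coercive: "a * (norm z)\<^sup>2 \<le> z \<bullet> (innov *v z)"
  using S_coercive[of z] mult_nonneg_nonneg[OF zero_le_power2[of \<epsilon>] R_nonneg[of z]]
  by (simp add: innov_mult inner_add_right)

lemma innov_mult_inv: "innov *v (matrix_inv innov *v z) = z"
proof -
  have "invertible innov"
    unfolding invertible_left_inverse matrix_left_invertible_ker
  proof (intro allI impI)
    fix x assume "innov *v x = 0"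
    then have "a * (norm x)\<^sup>2 \<le> 0" using innov_coercive[of x] by simp
    then show "x = 0" using a_pos by (simp add: mult_le_0_iff)
  qed
  then have "innov ** matrix_inv innov = mat 1"
    unfolding invertible_def matrix_inv_def by (rule someI2_ex) blast
  then show ?thesis by (simp add: matrix_vector_mul_assoc)
qed

text \<open>Coercivity at the preimage of \<open>z\<close>, together with Cauchy-Schwarz. The bound
  \<open>1 / a\<close> is uniform in \<open>\<epsilon>\<close>, on which the uniformity of the final
  constant rests.\<close>

lemma norm_innov_inv: "norm (matrix_inv innov *v z) \<le> norm z / a"
proof (cases "matrix_inv innov *v z = 0")
  case False
  let ?w = "matrix_inv innov *v z"
  have "a * (norm ?w)\<^sup>2 \<le> norm ?w * norm z"
    using innov_coercive[of ?w] norm_cauchy_schwarz[of ?w z] unfolding innov_mult_inv by simp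
  then show ?thesis using False a_pos by (simp add: power2_eq_square field_simps)
qed (use a_pos in simp)

lemma gain_eq: "gain z = S (Ha (matrix_inv innov *v z))"
  by (simp add: kgain_def innov_def)

text \<open>Completing the square: the Joseph form of the posterior covariance is minimal at the
  Kalman gain.\<close>

lemma joseph_form:
  defines "w0 \<equiv> \<lambda>h. matrix_inv innov *v H (S h)"
  shows "(h - Ha w) \<bullet> S (h - Ha w) + \<epsilon>\<^sup>2 * (w \<bullet> (R *v w)) =
    h \<bullet> posterior h + (w - w0 h) \<bullet> (innov *v (w - w0 h))"
proof -
  have sym: "x \<bullet> (innov *v y) = y \<bullet> (innov *v x)" for x y
  proof -
    have "x \<bullet> A y = y \<bullet> A x"
      using S_symmetric[of "Ha x" "Ha y"] adjoint[of x "S (Ha y)"] adjoint'[of "S (Ha x)" y]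
      by (simp add: inner_commute)
    then show ?thesis by (simp add: innov_mult inner_add_right R_symmetric[of x])
  qed
  have Mw0: "innov *v w0 h = H (S h)" by (simp add: w0_def innov_mult_inv)
  have "h \<bullet> gain (H (S h)) = w0 h \<bullet> H (S h)"
    using S_symmetric[of h] adjoint'[of "S h"] by (simp add: gain_eq w0_def inner_commute)
  then have post: "h \<bullet> posterior h = h \<bullet> S h - w0 h \<bullet> H (S h)"
    by (simp add: inner_diff_right)
  have "(h - Ha w) \<bullet> S (h - Ha w) = h \<bullet> S h - 2 * (w \<bullet> H (S h)) + w \<bullet> A w"
    using S_symmetric[of h "Ha w"] adjoint'[of "S h" w]
    by (simp add: linear_diff[OF linear_S] inner_diff_left inner_diff_right adjoint inner_commute)
  moreover have "w \<bullet> A w + \<epsilon>\<^sup>2 * (w \<bullet> (R *v w)) = w \<bullet> (innov *v w)"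
    by (simp add: innov_mult inner_add_right)
  moreover have "(w - w0 h) \<bullet> (innov *v (w - w0 h)) =
      w \<bullet> (innov *v w) - 2 * (w \<bullet> H (S h)) + w0 h \<bullet> H (S h)"
    using sym[of "w0 h" w]
    by (simp add: matrix_vector_mult_diff_distrib inner_diff_left inner_diff_right Mw0)
  ultimately show ?thesis by (simp add: post)
qed

text \<open>At the optimal \<open>?w\<close> the completed square vanishes, leaving a sum of two
  nonnegative terms.\<close>

lemma posterior_nonneg: "0 \<le> h \<bullet> posterior h"
proof -
  let ?w = "matrix_inv innov *v H (S h)"
  have "h \<bullet> posterior h = (h - Ha ?w) \<bullet> S (h - Ha ?w) + \<epsilon>\<^sup>2 * (?w \<bullet> (R *v ?w))"
    using joseph_form[of h ?w] by simp
  then show ?thesis using S_nonneg[of "h - Ha ?w"] R_nonneg[of ?w] by simp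
qed

text \<open>Every \<open>w\<close> acts as a suboptimal gain in direction \<open>h\<close>. Two
  choices matter: \<open>w = 0\<close> compares with the prior, \<open>w = z\<close> with the
  noise.\<close>

lemma posterior_le_joseph:
  "h \<bullet> posterior h \<le> (h - Ha w) \<bullet> S (h - Ha w) + \<epsilon>\<^sup>2 * (w \<bullet> (R *v w))"
  using innov_coercive[of "w - matrix_inv innov *v H (S h)"] a_pos
  by (simp only: joseph_form) (simp add: order_trans[rotated])

lemma posterior_le_prior: "h \<bullet> posterior h \<le> h \<bullet> S h"
  using posterior_le_joseph[of h 0] by (simp add: Ha_simps)

text \<open>With \<open>h = Ha z\<close> and \<open>w = z\<close> the prior term cancels, so an
  observed direction keeps at most the noise variance, however large \<open>S\<close> is.\<close>

lemma posterior_obs_le: "Ha z \<bullet> posterior (Ha z) \<le> \<epsilon>\<^sup>2 * (z \<bullet> (R *v z))"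
  using posterior_le_joseph[of "Ha z" z] by (simp add: linear_0[OF linear_S])

text \<open>Let \<open>N\<close> invert the innovation covariance. As
  \<open>A N + \<epsilon>\<^sup>2 R N = I\<close>, the forecast error \<open>d\<close> survives the
  update only as \<open>\<epsilon>\<^sup>2 R N d\<close>, next to the noise term
  \<open>\<epsilon> A N \<eta>\<close>.\<close>

lemma mean_obs_error:
  assumes cA: "\<And>z. norm (A z) \<le> cA * norm z" and K: "\<And>z. norm (R *v z) \<le> K * norm z"
  shows "norm (H (mu + gain (H u + \<epsilon> *\<^sub>R \<eta> - H mu)) - H u)
    \<le> \<epsilon> * (K / a + 1 + cA / a) * (norm (H u - H mu) + norm \<eta>)"
proof -
  define d where "d = H u - H mu"
  define N where "N = matrix_inv innov"
  \<comment> \<open>\<open>axis undefined 1\<close> is a unit vector; evaluating the bounds there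
    forces both constants to be nonnegative.\<close>
  have cA0: "0 \<le> cA" and K0: "0 \<le> K"
    using order_trans[OF norm_ge_zero cA[of "axis undefined 1"]]
      order_trans[OF norm_ge_zero K[of "axis undefined 1"]] by (simp_all add: norm_axis_1)
  have AN: "norm (A (N *v z)) \<le> cA / a * norm z" for z
    using order_trans[OF cA mult_left_mono[OF norm_innov_inv cA0]] by (simp add: N_def)
  have RN: "norm (R *v (N *v z)) \<le> K / a * norm z" for z
    using order_trans[OF K mult_left_mono[OF norm_innov_inv K0]] by (simp add: N_def)
  have split: "A (N *v z) + \<epsilon>\<^sup>2 *\<^sub>R (R *v (N *v z)) = z" for z
    using innov_mult_inv[of z] by (simp add: innov_mult N_def)
  have eq: "H (mu + gain (H u + \<epsilon> *\<^sub>R \<eta> - H mu)) - H u = \<epsilon> *\<^sub>R A (N *v \<eta>) - \<epsilon>\<^sup>2 *\<^sub>R (R *v (N *v d))"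
  proof -
    have y: "H u + \<epsilon> *\<^sub>R \<eta> - H mu = d + \<epsilon> *\<^sub>R \<eta>" by (simp add: d_def)
    have "H (mu + gain (H u + \<epsilon> *\<^sub>R \<eta> - H mu)) - H u = A (N *v (d + \<epsilon> *\<^sub>R \<eta>)) - d"
      unfolding y gain_eq N_def by (simp add: H_simps) (simp add: d_def)
    moreover have "A (N *v (d + \<epsilon> *\<^sub>R \<eta>)) = A (N *v d) + \<epsilon> *\<^sub>R A (N *v \<eta>)"
      by (simp add: matrix_vector_right_distrib matrix_vector_mult_scaleR Ha_simps H_simps
          linear_add[OF linear_S] linear_cmul[OF linear_S])
    moreover have "A (N *v d) = d - \<epsilon>\<^sup>2 *\<^sub>R (R *v (N *v d))"
      using split[of d] by (metis add_diff_cancel_right')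
    ultimately show ?thesis by simp
  qed
  \<comment> \<open>A bound linear in \<open>\<epsilon>\<close> is wanted for all
    \<open>\<epsilon>\<close>. If \<open>\<epsilon> \<le> 1\<close>, the square is below
    \<open>\<epsilon>\<close>; otherwise the term is rewritten as \<open>d - A (N *v d)\<close>,
    bounded by a constant multiple of \<open>norm d\<close>.\<close>
  have small: "norm (\<epsilon>\<^sup>2 *\<^sub>R (R *v (N *v d))) \<le> \<epsilon> * (K / a + 1 + cA / a) * norm d"
  proof (cases "\<epsilon> \<le> 1")
    case True
    have "norm (\<epsilon>\<^sup>2 *\<^sub>R (R *v (N *v d))) \<le> \<epsilon>\<^sup>2 * (K / a * norm d)"
      using mult_left_mono[OF RN[of d] zero_le_power2[of \<epsilon>]] by simp
    also have "\<dots> \<le> \<epsilon> * (K / a * norm d)"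
      using True \<epsilon>_pos K0 a_pos
      by (intro mult_right_mono) (auto simp: power2_eq_square mult_left_le)
    also have "\<dots> \<le> \<epsilon> * ((K / a + 1 + cA / a) * norm d)"
      using \<epsilon>_pos cA0 a_pos by (intro mult_left_mono mult_right_mono) auto
    finally show ?thesis by (simp add: mult.assoc)
  next
    case False
    have "\<epsilon>\<^sup>2 *\<^sub>R (R *v (N *v d)) = d - A (N *v d)"
      using split[of d] by (metis add_diff_cancel_left')
    then have "norm (\<epsilon>\<^sup>2 *\<^sub>R (R *v (N *v d))) \<le> norm d + cA / a * norm d"
      using norm_triangle_ineq4[of d "A (N *v d)"] AN[of d] by simp
    also have "\<dots> \<le> (K / a + 1 + cA / a) * norm d"
      using K0 a_pos by (simp add: algebra_simps)
    also have "\<dots> \<le> \<epsilon> * ((K / a + 1 + cA / a) * norm d)"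
      using mult_right_mono[of 1 \<epsilon> "(K / a + 1 + cA / a) * norm d"] False K0 cA0 a_pos by simp
    finally show ?thesis by (simp add: mult.assoc)
  qed
  have "norm (\<epsilon> *\<^sub>R A (N *v \<eta>)) \<le> \<epsilon> * (cA / a * norm \<eta>)"
    using mult_left_mono[OF AN[of \<eta>] less_imp_le[OF \<epsilon>_pos]] \<epsilon>_pos by simp
  also have "\<dots> \<le> \<epsilon> * ((K / a + 1 + cA / a) * norm \<eta>)"
    using \<epsilon>_pos K0 a_pos by (intro mult_left_mono mult_right_mono) auto
  finally have large: "norm (\<epsilon> *\<^sub>R A (N *v \<eta>)) \<le> \<epsilon> * (K / a + 1 + cA / a) * norm \<eta>"
    by (simp only: mult.assoc)
  show ?thesis
    unfolding eq distrib_left[of "\<epsilon> * (K / a + 1 + cA / a)"]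
    using small large norm_triangle_ineq4[of "\<epsilon> *\<^sub>R A (N *v \<eta>)" "\<epsilon>\<^sup>2 *\<^sub>R (R *v (N *v d))"]
    unfolding d_def by linarith
qed

end

section \<open>Mean and covariance of a bounded forecast\<close>

locale bounded_forecast = weighted_coisometry H Ha \<beta> + prob_space M
  for H :: "'a::{real_inner,polish_space} \<Rightarrow> real^'k" and Ha :: "real^'k \<Rightarrow> 'a" and \<beta> :: real
    and M :: "'b measure" +
  fixes f :: "'b \<Rightarrow> 'a" and \<rho> :: real
  assumes f_meas[measurable]: "f \<in> borel_measurable M"
    and f_bound: "\<And>x. x \<in> space M \<Longrightarrow> norm (f x) \<le> \<rho>"
begin

definition mean where "mean = (\<integral>x. f x \<partial>M)"
definition cov where "cov = (\<lambda>h. \<integral>x. ((f x - mean) \<bullet> h) *\<^sub>R (f x - mean) \<partial>M)"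

lemma Q_meas[measurable]: "(\<lambda>x. Q x) \<in> borel_measurable borel"
  by (intro borel_measurable_continuous_onI linear_continuous_on bounded_linear_Q)

lemma H_meas[measurable]: "H \<in> borel_measurable borel"
  by (intro borel_measurable_continuous_onI linear_continuous_on bounded_linear_H)

lemma Q_scaleR: "Q (c *\<^sub>R x) = c *\<^sub>R Q x"
  by (simp add: H_simps Ha_simps scaleR_diff_right)

lemma f_int: "integrable M f"
  using f_bound by (intro integrable_bounded_complete) auto

lemma \<rho>_nonneg: "0 \<le> \<rho>"
  using f_bound not_empty norm_ge_zero order_trans by blast

lemma expectation_const: "(\<integral>x. c \<partial>M) = (c::'a)"
  using integral_scaleR_left[of c M "\<lambda>_. 1"] by (simp add: prob_space)

lemma norm_mean: "norm mean \<le> \<rho>"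
  using norm_integral_le[OF f_int, of "\<lambda>_. \<rho>"] f_bound by (simp add: mean_def prob_space)

lemma norm_dev: "x \<in> space M \<Longrightarrow> norm (f x - mean) \<le> 2 * \<rho>"
  using norm_triangle_ineq4[of "f x" mean] f_bound[of x] norm_mean by simp

lemma norm_Q_dev: "x \<in> space M \<Longrightarrow> norm (Q (f x - mean)) \<le> 2 * \<rho>"
  using norm_Q_le norm_dev order_trans by blast

lemma cov_int: "integrable M (\<lambda>x. ((f x - mean) \<bullet> h) *\<^sub>R (f x - mean))"
proof (rule integrable_bounded_complete)
  show "norm (((f x - mean) \<bullet> h) *\<^sub>R (f x - mean)) \<le> (2 * \<rho> * norm h) * (2 * \<rho>)" if "x \<in> space M" for x
    using order_trans[OF Cauchy_Schwarz_ineq2 mult_right_mono[OF norm_dev[OF that]], of h]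
      norm_dev[OF that] \<rho>_nonneg by (simp only: norm_scaleR real_norm_def) (intro mult_mono, auto)
qed simp

lemma inner_cov: "h' \<bullet> cov h = (\<integral>x. ((f x - mean) \<bullet> h) * ((f x - mean) \<bullet> h') \<partial>M)"
  using integral_inner_right[of h' M, OF cov_int[of h]] by (simp add: cov_def inner_commute)

lemma cov_symmetric: "cov x \<bullet> y = x \<bullet> cov y"
  by (simp add: inner_cov inner_commute[of "cov x"] mult.commute)

lemma linear_cov: "linear cov"
  by (rule linearI)
     (simp_all add: cov_def inner_add_right scaleR_add_left cov_int flip: scaleR_scaleR)

lemma cov_nonneg: "0 \<le> h \<bullet> cov h"
  by (simp add: inner_cov)

text \<open>Brought to the same form as \<open>is_gaussian_second_moment\<close>, so that
  covariances can be compared direction by direction.\<close>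

lemma nn_integral_cov: "(\<integral>\<^sup>+x. ennreal ((h \<bullet> (f x - mean))\<^sup>2) \<partial>M) = ennreal (h \<bullet> cov h)"
proof -
  have "integrable M (\<lambda>x. ((f x - mean) \<bullet> h)\<^sup>2)"
    using integrable_inner_right[of h, OF cov_int[of h]] by (simp add: inner_commute power2_eq_square)
  then show ?thesis
    by (simp add: inner_cov nn_integral_eq_integral inner_commute[of h] flip: power2_eq_square)
qed

lemma Q_dev_int: "integrable M (\<lambda>x. norm (Q (f x - c)))" "integrable M (\<lambda>x. (norm (Q (f x - c)))\<^sup>2)"
proof -
  have b: "norm (Q (f x - c)) \<le> \<rho> + norm c" if "x \<in> space M" for x
    using norm_Q_le[of "f x - c"] norm_triangle_ineq4[of "f x" c] f_bound[OF that] by linarith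
  show "integrable M (\<lambda>x. norm (Q (f x - c)))" "integrable M (\<lambda>x. (norm (Q (f x - c)))\<^sup>2)"
    using b by (intro integrable_const_bound[where B="\<rho> + norm c"]
        integrable_const_bound[where B="(\<rho> + norm c)\<^sup>2"] AE_I2; simp add: power_mono)+
qed

lemma Q_mean: "norm (Q (mean - c)) \<le> (\<integral>x. norm (Q (f x - c)) \<partial>M)"
proof -
  have i: "integrable M (\<lambda>x. f x - c)" by (intro Bochner_Integration.integrable_diff f_int) simp
  have "(\<integral>x. Q (f x - c) \<partial>M) = Q (\<integral>x. f x - c \<partial>M)"
    by (rule integral_bounded_linear[OF bounded_linear_Q i])
  also have "(\<integral>x. f x - c \<partial>M) = mean - c"
    using f_int by (simp add: mean_def expectation_const)
  finally show ?thesis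
    using norm_integral_le[OF integrable_bounded_linear[OF bounded_linear_Q i] Q_dev_int(1)[of c]]
    by simp
qed

text \<open>The cross term integrates to zero, so moving the centre from \<open>mean\<close> to
  \<open>c\<close> only adds the square of \<open>norm (Q (mean - c))\<close>.\<close>

lemma Q_variance_minimal:
  "(\<integral>x. (norm (Q (f x - mean)))\<^sup>2 \<partial>M) \<le> (\<integral>x. (norm (Q (f x - c)))\<^sup>2 \<partial>M)"
proof -
  have i: "integrable M (\<lambda>x. Q (f x - mean))"
    by (intro integrable_bounded_linear[OF bounded_linear_Q] Bochner_Integration.integrable_diff f_int) simp
  have "(\<integral>x. Q (f x - mean) \<partial>M) = Q (\<integral>x. f x - mean \<partial>M)"
    by (intro integral_bounded_linear[OF bounded_linear_Q] Bochner_Integration.integrable_diff f_int) simp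
  also have "(\<integral>x. f x - mean \<partial>M) = 0"
    using f_int by (simp add: mean_def expectation_const)
  finally have zero: "(\<integral>x. Q (f x - mean) \<bullet> Q (mean - c) \<partial>M) = 0"
    using i by (simp add: H_simps Ha_simps)
  have "(norm (Q (f x - c)))\<^sup>2 = (norm (Q (f x - mean)))\<^sup>2
      + 2 * (Q (f x - mean) \<bullet> Q (mean - c)) + (norm (Q (mean - c)))\<^sup>2" for x
  proof -
    have "Q (f x - c) = Q (f x - mean) + Q (mean - c)"
      by (simp add: H_simps Ha_simps)
    then show ?thesis
      by (simp only: power2_norm_eq_inner inner_add_left inner_add_right inner_commute)
  qed
  then have "(\<integral>x. (norm (Q (f x - c)))\<^sup>2 \<partial>M) =
      (\<integral>x. (norm (Q (f x - mean)))\<^sup>2 + 2 * (Q (f x - mean) \<bullet> Q (mean - c)) + (norm (Q (mean - c)))\<^sup>2 \<partial>M)"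
    by presburger
  also have "\<dots> = (\<integral>x. (norm (Q (f x - mean)))\<^sup>2 \<partial>M) + (norm (Q (mean - c)))\<^sup>2"
    using zero integrable_inner_left[OF i, of "Q (mean - c)"] Q_dev_int(2)[of mean]
    by (simp add: prob_space del: integral_inner_left)
  finally show ?thesis by simp
qed

lemma norm_cov_le: "norm (cov h) \<le> 4 * \<rho>\<^sup>2 * norm h"
proof -
  have "norm (((f x - mean) \<bullet> h) *\<^sub>R (f x - mean)) \<le> (2 * \<rho> * norm h) * (2 * \<rho>)" if "x \<in> space M" for x
    using order_trans[OF Cauchy_Schwarz_ineq2 mult_right_mono[OF norm_dev[OF that]], of h]
      norm_dev[OF that] \<rho>_nonneg by (simp only: norm_scaleR real_norm_def) (intro mult_mono, auto)
  then show ?thesis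
    using norm_integral_le[OF cov_int[of h], of "\<lambda>_. (2 * \<rho> * norm h) * (2 * \<rho>)"]
    by (simp add: cov_def prob_space power2_eq_square mult_ac)
qed

text \<open>One factor of the covariance is bounded crudely by \<open>2 * \<rho>\<close>, the other
  is kept under \<open>Q\<close>: the covariance into the unobserved directions is as small as the
  unobserved deviation.\<close>

lemma norm_Q_cov_le: "norm (Q (cov h)) \<le> 2 * \<rho> * norm h * (\<integral>x. norm (Q (f x - mean)) \<partial>M)"
proof -
  have le: "norm (Q (((f x - mean) \<bullet> h) *\<^sub>R (f x - mean))) \<le> (2 * \<rho> * norm h) * norm (Q (f x - mean))"
    if "x \<in> space M" for x
    using mult_right_mono[OF order_trans[OF Cauchy_Schwarz_ineq2 mult_right_mono[OF norm_dev[OF that]], of h],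
        of "norm (Q (f x - mean))"]
    by (simp only: Q_scaleR norm_scaleR) simp
  have "norm (Q (cov h)) = norm (\<integral>x. Q (((f x - mean) \<bullet> h) *\<^sub>R (f x - mean)) \<partial>M)"
    unfolding cov_def by (subst integral_bounded_linear[OF bounded_linear_Q cov_int]) simp
  also have "\<dots> \<le> (\<integral>x. (2 * \<rho> * norm h) * norm (Q (f x - mean)) \<partial>M)"
    by (intro norm_integral_le integrable_bounded_linear[OF bounded_linear_Q cov_int] le
        integrable_mult_right Q_dev_int)
  finally show ?thesis by simp
qed

end

section \<open>One step of the projected filter\<close>

text \<open>The truth follows \<open>\<Psi>\<close> while the filter uses an abstract
  \<open>F\<close>, so one analysis serves both filters.\<close>

locale gpf_setting = weighted_coisometry H Ha \<beta>
  for H :: "'a::{real_inner,polish_space} \<Rightarrow> real^'k" and Ha :: "real^'k \<Rightarrow> 'a" and \<beta> :: real +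
  fixes \<Psi> F :: "'a \<Rightarrow> 'a" and r \<alpha> \<kappa> \<delta> \<Lambda> a \<epsilon> :: real and R :: "real^'k^'k"
  assumes r_pos: "0 < r" and \<alpha>: "0 < \<alpha>" "\<alpha> < 1" and \<kappa>_nonneg: "0 \<le> \<kappa>" and \<delta>_nonneg: "0 \<le> \<delta>"
    and a_pos': "0 < a" and \<epsilon>_pos': "0 < \<epsilon>"
    and invariant: "\<And>u. norm u \<le> r \<Longrightarrow> norm (\<Psi> u) \<le> r"
    and contracting: "\<And>u v. norm u \<le> r \<Longrightarrow> norm v \<le> r \<Longrightarrow>
      (Vnorm P \<beta> (Q (\<Psi> u - \<Psi> v)))\<^sup>2 \<le> \<alpha> * (Vnorm P \<beta> (u - v))\<^sup>2"
    and model_error: "\<And>u. norm u \<le> r \<Longrightarrow> norm (F u - \<Psi> u) \<le> \<kappa>"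
    and model_error_Q: "\<And>u. norm u \<le> r \<Longrightarrow> norm (Q (F u - \<Psi> u)) \<le> \<delta>"
    and F_lipschitz: "\<And>u v. norm u \<le> r \<Longrightarrow> norm v \<le> r \<Longrightarrow>
      (Vnorm P \<beta> (F u - F v))\<^sup>2 \<le> \<Lambda> * (Vnorm P \<beta> (u - v))\<^sup>2"
    and R_symmetric': "\<And>x y. x \<bullet> (R *v y) = y \<bullet> (R *v x)"
    and R_nonneg': "\<And>x. 0 \<le> x \<bullet> (R *v x)"
begin

abbreviation proj where "proj \<equiv> projBV P \<beta> r"
abbreviation Fp where "Fp \<equiv> (\<lambda>u. F (proj u))"
abbreviation \<rho> where "\<rho> \<equiv> r + \<kappa>"

lemma norm_proj: "norm (proj u) \<le> r"
  by (rule projBV_variational(1)[OF r_pos])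

lemma norm_F: "norm u \<le> r \<Longrightarrow> norm (F u) \<le> \<rho>"
  using norm_triangle_ineq[of "F u - \<Psi> u" "\<Psi> u"] model_error[of u] invariant[of u] by simp

text \<open>The projection is nonexpansive in \<open>V\<close>, \<open>F\<close> is Lipschitz on the
  ball, and \<open>V\<close> is equivalent to the norm. Measurability of \<open>Fp\<close>
  follows.\<close>

lemma Fp_continuous: "continuous_on UNIV Fp"
proof -
  let ?c = "sqrt (\<bar>\<Lambda>\<bar> * (1 + \<beta>))"
  have "norm (Fp u - Fp v) \<le> ?c * norm (u - v)" for u v
  proof (rule power2_le_imp_le)
    have "(norm (Fp u - Fp v))\<^sup>2 \<le> (V (Fp u - Fp v))\<^sup>2"
      by (intro power_mono norm_le_Vnorm) simp
    also have "\<dots> \<le> \<Lambda> * (V (proj u - proj v))\<^sup>2" by (intro F_lipschitz norm_proj)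
    also have "\<dots> \<le> \<bar>\<Lambda>\<bar> * (V (u - v))\<^sup>2"
      by (intro mult_mono power_mono projBV_nonexpansive r_pos Vnorm_nonneg) auto
    also have "\<dots> \<le> \<bar>\<Lambda>\<bar> * (sqrt (1 + \<beta>) * norm (u - v))\<^sup>2"
      by (intro mult_left_mono power_mono Vnorm_le_norm Vnorm_nonneg) auto
    finally show "(norm (Fp u - Fp v))\<^sup>2 \<le> (?c * norm (u - v))\<^sup>2"
      using \<beta>_nonneg by (simp add: power_mult_distrib)
  qed (use \<beta>_nonneg in simp)
  then have "?c-lipschitz_on UNIV Fp"
    using \<beta>_nonneg by (intro lipschitz_onI) (simp_all add: dist_norm)
  then show ?thesis by (rule lipschitz_on_continuous_on)
qed

lemma Fp_measurable[measurable]: "Fp \<in> borel_measurable borel"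
  by (rule borel_measurable_continuous_onI[OF Fp_continuous])

text \<open>Inserting \<open>\<Psi> (proj u)\<close> separates the model error, at most
  \<open>\<delta>\<close> under \<open>Q\<close>, from the contraction of \<open>Q \<Psi>\<close>.
  The Lipschitz constant of \<open>F\<close> does not appear, so the factor stays below one.\<close>

lemma Fp_error_Q: "norm (Q (Fp u - \<Psi> (proj v))) \<le> \<delta> + sqrt \<alpha> * V (u - v)"
proof -
  have "norm (Q (\<Psi> (proj u) - \<Psi> (proj v))) \<le> V (Q (\<Psi> (proj u) - \<Psi> (proj v)))"
    by (rule norm_le_Vnorm)
  also have "\<dots> \<le> sqrt \<alpha> * V (proj u - proj v)"
  proof (rule power2_le_imp_le)
    show "(V (Q (\<Psi> (proj u) - \<Psi> (proj v))))\<^sup>2 \<le> (sqrt \<alpha> * V (proj u - proj v))\<^sup>2"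
      using contracting[OF norm_proj norm_proj, of u v] \<alpha> by (simp add: power_mult_distrib)
  qed (use \<alpha> Vnorm_nonneg in simp)
  also have "\<dots> \<le> sqrt \<alpha> * V (u - v)"
    using \<alpha> by (intro mult_left_mono projBV_nonexpansive r_pos) simp
  finally have *: "norm (Q (\<Psi> (proj u) - \<Psi> (proj v))) \<le> sqrt \<alpha> * V (u - v)" .
  have eq: "Q (Fp u - \<Psi> (proj v)) = Q (F (proj u) - \<Psi> (proj u)) + Q (\<Psi> (proj u) - \<Psi> (proj v))"
    by (simp add: H_simps Ha_simps)
  show ?thesis unfolding eq
    using norm_triangle_ineq[of "Q (F (proj u) - \<Psi> (proj u))" "Q (\<Psi> (proj u) - \<Psi> (proj v))"]
      model_error_Q[OF norm_proj, of u] * by linarith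
qed

lemma V_measurable[measurable]: "(\<lambda>u. V u) \<in> borel_measurable borel"
proof -
  have [measurable]: "H \<in> borel_measurable borel"
    by (intro borel_measurable_continuous_onI linear_continuous_on bounded_linear_H)
  show ?thesis unfolding Vnorm_def norm_Ha by measurable
qed

end

locale gpf_step = gpf_setting H Ha \<beta> \<Psi> F r \<alpha> \<kappa> \<delta> \<Lambda> a \<epsilon> R + prob_space G
  for H :: "'a::{real_inner,polish_space} \<Rightarrow> real^'k" and Ha :: "real^'k \<Rightarrow> 'a" and \<beta> :: real
    and \<Psi> F :: "'a \<Rightarrow> 'a" and r \<alpha> \<kappa> \<delta> \<Lambda> a \<epsilon> :: real and R :: "real^'k^'k"
    and G :: "'a measure" +
  assumes sets_G[measurable_cong]: "sets G = sets borel"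
begin

sublocale bounded_forecast H Ha \<beta> G Fp \<rho>
  by unfold_locales (use norm_F norm_proj in auto)

definition S where "S = (\<lambda>x. cov x + a *\<^sub>R Ha (H x))"

sublocale kalman_update H Ha \<beta> S R \<epsilon> a
proof (intro kalman_update.intro kalman_update_axioms.intro weighted_coisometry_axioms)
  show "linear S"
    using linear_cov unfolding S_def
    by (intro linear_compose_add linear_compose_scale_right)
       (auto intro!: bounded_linear.linear bounded_linear_compose[OF bounded_linear_Ha bounded_linear_H])
  show "S x \<bullet> y = x \<bullet> S y" for x y
    by (simp add: S_def inner_add_left inner_add_right cov_symmetric adjoint adjoint')
  show "0 \<le> x \<bullet> S x" for x
    using cov_nonneg a_pos' by (simp add: S_def inner_add_right adjoint' add_nonneg_nonneg)
  show "a * (norm z)\<^sup>2 \<le> z \<bullet> H (S (Ha z))" for z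
    using cov_nonneg[of "Ha z"]
    by (simp add: S_def H_simps inner_add_right coisometry adjoint power2_norm_eq_inner)
qed (use R_symmetric' R_nonneg' a_pos' \<epsilon>_pos' in auto)

text \<open>The square root of the trace of \<open>Q cov Q\<close>.\<close>

definition spread where "spread = sqrt (\<integral>u. (norm (Q (Fp u - mean)))\<^sup>2 \<partial>G)"

lemma spread_nonneg: "0 \<le> spread"
  by (simp add: spread_def)

text \<open>By \<open>Q_variance_minimal\<close> the mean may be replaced by
  \<open>\<Psi> (proj m)\<close>, where the pointwise bound \<open>Fp_error_Q\<close> applies; its
  integrated square is at most a perfect square.\<close>

lemma spread_le:
  assumes T: "integrable G (\<lambda>u. (V (u - m))\<^sup>2)"
  shows "spread \<le> \<delta> + sqrt \<alpha> * sqrt (\<integral>u. (V (u - m))\<^sup>2 \<partial>G)"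
proof -
  let ?t = "sqrt (\<integral>u. (V (u - m))\<^sup>2 \<partial>G)"
  have V: "integrable G (\<lambda>u. V (u - m))" "(\<integral>u. V (u - m) \<partial>G) \<le> ?t"
    by (rule integral_le_sqrt_integral_square[OF _ T]; measurable)+
  have t: "?t\<^sup>2 = (\<integral>u. (V (u - m))\<^sup>2 \<partial>G)" by simp
  have "(\<integral>u. (norm (Q (Fp u - mean)))\<^sup>2 \<partial>G) \<le> (\<integral>u. (norm (Q (Fp u - \<Psi> (proj m))))\<^sup>2 \<partial>G)"
    by (rule Q_variance_minimal)
  also have "\<dots> \<le> (\<integral>u. \<delta>\<^sup>2 + 2 * \<delta> * sqrt \<alpha> * V (u - m) + \<alpha> * (V (u - m))\<^sup>2 \<partial>G)"
  proof (intro integral_mono Q_dev_int)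
    show "(norm (Q (Fp u - \<Psi> (proj m))))\<^sup>2 \<le> \<delta>\<^sup>2 + 2 * \<delta> * sqrt \<alpha> * V (u - m) + \<alpha> * (V (u - m))\<^sup>2" for u
      using power_mono[OF Fp_error_Q[of u m] norm_ge_zero, of 2] \<alpha>
      by (simp add: power2_sum power_mult_distrib algebra_simps)
  qed (use V T in auto)
  also have "\<dots> = \<delta>\<^sup>2 + 2 * \<delta> * sqrt \<alpha> * (\<integral>u. V (u - m) \<partial>G) + \<alpha> * ?t\<^sup>2"
    using V T unfolding t by (simp add: prob_space)
  also have "\<dots> \<le> \<delta>\<^sup>2 + 2 * \<delta> * sqrt \<alpha> * ?t + \<alpha> * ?t\<^sup>2"
    using V(2) \<delta>_nonneg \<alpha> by (intro add_mono mult_left_mono) auto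
  also have "\<dots> = (\<delta> + sqrt \<alpha> * ?t)\<^sup>2"
    using \<alpha> by (simp add: power2_sum power_mult_distrib algebra_simps)
  finally show ?thesis
    unfolding spread_def using \<delta>_nonneg \<alpha> by (intro real_le_lsqrt) auto
qed

text \<open>No moment of \<open>G\<close> enters, so this bound is available at the start of the
  recursion, and it tames the product of noise and spread in \<open>update_error_Q\<close>.\<close>

lemma spread_le_bound: "spread \<le> 2 * \<rho>"
proof -
  have "(\<integral>u. (norm (Q (Fp u - mean)))\<^sup>2 \<partial>G) \<le> (\<integral>u. (2 * \<rho>)\<^sup>2 \<partial>G)"
    by (intro integral_mono Q_dev_int power_mono norm_Q_dev) auto
  then show ?thesis
    unfolding spread_def using \<rho>_nonneg by (intro real_le_lsqrt) (auto simp: prob_space)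
qed

text \<open>The trace splits into an unobserved part, dominated by the prior, and an observed part,
  dominated by the trace of the noise covariance. Finiteness of both also yields the integrability
  needed at the next step.\<close>

lemma posterior_spread:
  assumes G': "is_gaussian G' m' posterior"
  defines "K \<equiv> \<Sum>b\<in>Basis. b \<bullet> (R *v b)"
  shows "integrable G' (\<lambda>u. (V (u - m'))\<^sup>2)"
    and "sqrt (\<integral>u. (V (u - m'))\<^sup>2 \<partial>G') \<le> spread + \<epsilon> * sqrt ((1 + \<beta>) * K)"
proof -
  interpret G': prob_space G' using G' by (simp add: is_gaussian_def)
  have [measurable_cong]: "sets G' = sets borel" using G' by (simp add: is_gaussian_def)
  have K: "0 \<le> K" unfolding K_def by (intro sum_nonneg R_nonneg)
  have Qsym: "h \<bullet> Q x = Q h \<bullet> x" for h x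
    by (simp add: inner_diff_left inner_diff_right adjoint adjoint')
  have "(\<integral>\<^sup>+u. ennreal ((norm (Q (u - m')))\<^sup>2) \<partial>G') \<le> (\<integral>\<^sup>+u. ennreal ((norm (Q (Fp u - mean)))\<^sup>2) \<partial>G)"
  proof (rule nn_integral_norm_square_mono)
    fix h
    have "(\<integral>\<^sup>+u. ennreal ((h \<bullet> Q (u - m'))\<^sup>2) \<partial>G') = ennreal (Q h \<bullet> posterior (Q h))"
      unfolding Qsym by (rule is_gaussian_second_moment[OF G' posterior_nonneg])
    also have "\<dots> \<le> ennreal (Q h \<bullet> S (Q h))"
      by (intro ennreal_leI posterior_le_prior)
    \<comment> \<open>The inflation vanishes on \<open>Q h\<close>, which \<open>H\<close>
      annihilates, so \<open>a\<close> does not enter the spread.\<close>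
    also have "\<dots> = ennreal (Q h \<bullet> cov (Q h))"
      by (simp only: S_def H_Q) (simp add: Ha_simps)
    also have "\<dots> = (\<integral>\<^sup>+u. ennreal ((h \<bullet> Q (Fp u - mean))\<^sup>2) \<partial>G)"
      unfolding Qsym by (rule nn_integral_cov[symmetric])
    finally show "(\<integral>\<^sup>+u. ennreal ((h \<bullet> Q (u - m'))\<^sup>2) \<partial>G') \<le> (\<integral>\<^sup>+u. ennreal ((h \<bullet> Q (Fp u - mean))\<^sup>2) \<partial>G)" .
  qed measurable
  also have "\<dots> = ennreal (spread\<^sup>2)"
    using Q_dev_int(2)[of mean] by (simp add: spread_def nn_integral_eq_integral)
  finally have Qpart: "(\<integral>\<^sup>+u. ennreal ((norm (Q (u - m')))\<^sup>2) \<partial>G') \<le> ennreal (spread\<^sup>2)" .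
  have "(\<integral>\<^sup>+u. ennreal ((norm (H (u - m')))\<^sup>2) \<partial>G')
      = (\<integral>\<^sup>+u. (\<Sum>b\<in>Basis. ennreal ((Ha b \<bullet> (u - m'))\<^sup>2)) \<partial>G')"
    unfolding power2_norm_eq_inner euclidean_inner[of "H _" "H _"]
    by (simp add: adjoint inner_commute[of _ "H _"] power2_eq_square flip: sum_ennreal)
  also have "\<dots> = (\<Sum>b\<in>Basis. \<integral>\<^sup>+u. ennreal ((Ha b \<bullet> (u - m'))\<^sup>2) \<partial>G')"
    by (rule nn_integral_sum) measurable
  also have "\<dots> = (\<Sum>b\<in>Basis. ennreal (Ha b \<bullet> posterior (Ha b)))"
    by (intro sum.cong refl is_gaussian_second_moment[OF G' posterior_nonneg])
  also have "\<dots> \<le> (\<Sum>b\<in>Basis. ennreal (\<epsilon>\<^sup>2 * (b \<bullet> (R *v b))))"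
    by (intro sum_mono ennreal_leI posterior_obs_le)
  also have "\<dots> = ennreal (\<epsilon>\<^sup>2 * K)"
    using R_nonneg by (subst sum_ennreal) (auto simp: K_def sum_distrib_left)
  finally have Hpart: "(\<integral>\<^sup>+u. ennreal ((norm (H (u - m')))\<^sup>2) \<partial>G') \<le> ennreal (\<epsilon>\<^sup>2 * K)" .
  have "(\<integral>\<^sup>+u. ennreal ((V (u - m'))\<^sup>2) \<partial>G') =
      (\<integral>\<^sup>+u. ennreal ((norm (Q (u - m')))\<^sup>2) + ennreal (1 + \<beta>) * ennreal ((norm (H (u - m')))\<^sup>2) \<partial>G')"
    unfolding Vnorm_square using \<beta>_nonneg
    by (intro nn_integral_cong) (simp add: ennreal_plus ennreal_mult)
  also have "\<dots> = (\<integral>\<^sup>+u. ennreal ((norm (Q (u - m')))\<^sup>2) \<partial>G')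
      + ennreal (1 + \<beta>) * (\<integral>\<^sup>+u. ennreal ((norm (H (u - m')))\<^sup>2) \<partial>G')"
    by (subst nn_integral_add) (auto simp: nn_integral_cmult)
  also have "\<dots> \<le> ennreal (spread\<^sup>2) + ennreal (1 + \<beta>) * ennreal (\<epsilon>\<^sup>2 * K)"
    by (intro add_mono mult_left_mono Qpart Hpart) simp
  also have "\<dots> = ennreal (spread\<^sup>2 + \<epsilon>\<^sup>2 * ((1 + \<beta>) * K))"
  proof -
    have "ennreal (1 + \<beta>) * ennreal (\<epsilon>\<^sup>2 * K) = ennreal (\<epsilon>\<^sup>2 * ((1 + \<beta>) * K))"
      using \<beta>_nonneg K by (subst ennreal_mult[symmetric]) (auto simp: mult_ac)
    then show ?thesis using \<beta>_nonneg K by (simp only:) (simp add: ennreal_plus)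
  qed
  finally have le: "(\<integral>\<^sup>+u. ennreal ((V (u - m'))\<^sup>2) \<partial>G') \<le> ennreal (spread\<^sup>2 + \<epsilon>\<^sup>2 * ((1 + \<beta>) * K))" .
  show int: "integrable G' (\<lambda>u. (V (u - m'))\<^sup>2)"
    by (rule integrableI_nonneg) (use le in \<open>auto intro: le_less_trans\<close>)
  have "(\<integral>u. (V (u - m'))\<^sup>2 \<partial>G') \<le> spread\<^sup>2 + \<epsilon>\<^sup>2 * ((1 + \<beta>) * K)"
    using le K \<beta>_nonneg
    by (subst (asm) nn_integral_eq_integral[OF int], simp) (subst (asm) ennreal_le_iff, auto)
  then have "sqrt (\<integral>u. (V (u - m'))\<^sup>2 \<partial>G') \<le> sqrt (spread\<^sup>2 + \<epsilon>\<^sup>2 * ((1 + \<beta>) * K))"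
    by simp
  also have "\<dots> \<le> sqrt (spread\<^sup>2) + sqrt (\<epsilon>\<^sup>2 * ((1 + \<beta>) * K))"
    using K \<beta>_nonneg by (intro sqrt_add_le_add_sqrt) auto
  also have "\<dots> = spread + \<epsilon> * sqrt ((1 + \<beta>) * K)"
    using spread_nonneg \<epsilon>_pos by (simp add: real_sqrt_mult)
  finally show "sqrt (\<integral>u. (V (u - m'))\<^sup>2 \<partial>G') \<le> spread + \<epsilon> * sqrt ((1 + \<beta>) * K)" .
qed

lemma norm_truth_diff: "norm u \<le> r \<Longrightarrow> norm (u - mean) \<le> 2 * \<rho>"
  using norm_triangle_ineq4[of u mean] norm_mean \<kappa>_nonneg by simp

abbreviation mean_update where "mean_update u \<eta> \<equiv> mean + gain (H u + \<epsilon> *\<^sub>R \<eta> - H mean)"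

lemma update_error_H:
  assumes u: "norm u \<le> r" and K: "\<And>z. norm (R *v z) \<le> K * norm z"
  shows "norm (H (mean_update u \<eta> - u)) \<le> \<epsilon> * (K / a + 1 + (4 * \<rho>\<^sup>2 + a) / a) * (2 * \<rho> + norm \<eta>)"
proof -
  have A: "norm (A z) \<le> (4 * \<rho>\<^sup>2 + a) * norm z" for z
  proof -
    have "norm (A z) \<le> norm (H (cov (Ha z))) + a * norm z"
      using norm_triangle_ineq[of "H (cov (Ha z))" "a *\<^sub>R z"] a_pos
      by (simp add: S_def H_simps coisometry)
    also have "norm (H (cov (Ha z))) \<le> 4 * \<rho>\<^sup>2 * norm z"
      using order_trans[OF norm_H_le norm_cov_le[of "Ha z"]] by (simp add: norm_Ha)
    finally show ?thesis by (simp add: algebra_simps)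
  qed
  have K0: "0 \<le> K"
    using order_trans[OF norm_ge_zero K[of "axis undefined 1"]] by (simp add: norm_axis_1)
  have "norm (H u - H mean) \<le> 2 * \<rho>"
    using order_trans[OF norm_H_le norm_truth_diff[OF u]] by (simp add: H_simps)
  then have "\<epsilon> * (K / a + 1 + (4 * \<rho>\<^sup>2 + a) / a) * (norm (H u - H mean) + norm \<eta>)
      \<le> \<epsilon> * (K / a + 1 + (4 * \<rho>\<^sup>2 + a) / a) * (2 * \<rho> + norm \<eta>)"
    using K0 a_pos \<epsilon>_pos by (intro mult_left_mono) auto
  with mean_obs_error[OF A K, of mean u \<eta>] show ?thesis by (simp add: H_simps)
qed

text \<open>\<open>Q\<close> removes the inflation from \<open>S\<close>, so the gain reaches the
  unobserved directions only through \<open>Q cov\<close>, which is controlled by the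
  spread.\<close>

lemma update_error_Q:
  assumes u: "norm u \<le> r"
  shows "norm (Q (mean_update u \<eta> - u)) \<le> norm (Q (mean - u))
    + 4 * \<rho>\<^sup>2 / a * spread + 4 * \<rho>\<^sup>2 / a * (\<epsilon> * norm \<eta>)"
proof -
  define z where "z = H u + \<epsilon> *\<^sub>R \<eta> - H mean"
  let ?w = "Ha (matrix_inv innov *v z)"
  have "norm (H u - H mean) \<le> 2 * \<rho>"
    using order_trans[OF norm_H_le norm_truth_diff[OF u]] by (simp add: H_simps)
  moreover have "z = (H u - H mean) + \<epsilon> *\<^sub>R \<eta>" by (simp add: z_def)
  ultimately have z: "norm z \<le> 2 * \<rho> + \<epsilon> * norm \<eta>"
    using norm_triangle_ineq[of "H u - H mean" "\<epsilon> *\<^sub>R \<eta>"] \<epsilon>_pos by simp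
  have dev: "(\<integral>u. norm (Q (Fp u - mean)) \<partial>G) \<le> spread"
    unfolding spread_def
    by (intro integral_le_sqrt_integral_square(2) Q_dev_int) measurable
  have "Q (S x) = Q (cov x)" for x
    by (simp add: S_def H_simps Ha_simps coisometry)
  then have "Q (gain z) = Q (cov ?w)" by (simp only: gain_eq)
  then have "norm (Q (gain z)) \<le> 2 * \<rho> * norm ?w * (\<integral>u. norm (Q (Fp u - mean)) \<partial>G)"
    using norm_Q_cov_le[of ?w] by simp
  also have "\<dots> \<le> 2 * \<rho> * (norm z / a) * spread"
    using dev norm_innov_inv[of z] \<rho>_nonneg a_pos
    by (intro mult_mono) (auto simp: norm_Ha)
  also have "\<dots> \<le> 2 * \<rho> * ((2 * \<rho> + \<epsilon> * norm \<eta>) / a) * spread"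
    using z \<rho>_nonneg a_pos spread_nonneg
    by (intro mult_right_mono mult_left_mono divide_right_mono) auto
  also have "\<dots> = 4 * \<rho>\<^sup>2 / a * spread + 2 * \<rho> / a * (\<epsilon> * norm \<eta>) * spread"
    by (simp add: power2_eq_square add_divide_distrib algebra_simps)
  \<comment> \<open>In the product of noise and spread the spread is replaced by its constant bound,
    which keeps the recursion linear.\<close>
  also have "\<dots> \<le> 4 * \<rho>\<^sup>2 / a * spread + 2 * \<rho> / a * (\<epsilon> * norm \<eta>) * (2 * \<rho>)"
    using spread_le_bound \<rho>_nonneg a_pos \<epsilon>_pos by (intro add_left_mono mult_left_mono) auto
  also have "\<dots> = 4 * \<rho>\<^sup>2 / a * spread + 4 * \<rho>\<^sup>2 / a * (\<epsilon> * norm \<eta>)"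
    by (simp add: power2_eq_square) (simp add: algebra_simps)
  finally have "norm (Q (gain z)) \<le> 4 * \<rho>\<^sup>2 / a * spread + 4 * \<rho>\<^sup>2 / a * (\<epsilon> * norm \<eta>)" .
  moreover have eq: "Q (mean_update u \<eta> - u) = Q (mean - u) + Q (gain z)"
    by (simp add: z_def H_simps Ha_simps)
  ultimately show ?thesis
    unfolding eq using norm_triangle_ineq[of "Q (mean - u)" "Q (gain z)"] by linarith
qed

text \<open>Jensen's inequality moves the norm inside the integral; \<open>V (u - v)\<close> then
  splits into the previous mean error and the deviation of the Gaussian from its mean.\<close>

lemma forecast_error_Q:
  assumes v: "norm v \<le> r" and T: "integrable G (\<lambda>u. (V (u - m))\<^sup>2)"
  shows "norm (Q (mean - \<Psi> v)) \<le> \<delta> + sqrt \<alpha> * (V (m - v) + sqrt (\<integral>u. (V (u - m))\<^sup>2 \<partial>G))"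
proof -
  have Vi: "integrable G (\<lambda>u. V (u - m))" "(\<integral>u. V (u - m) \<partial>G) \<le> sqrt (\<integral>u. (V (u - m))\<^sup>2 \<partial>G)"
    by (rule integral_le_sqrt_integral_square[OF _ T]; measurable)+
  have "norm (Q (mean - \<Psi> v)) \<le> (\<integral>u. norm (Q (Fp u - \<Psi> v)) \<partial>G)"
    by (rule Q_mean)
  also have "\<dots> \<le> (\<integral>u. \<delta> + sqrt \<alpha> * (V (m - v) + V (u - m)) \<partial>G)"
  proof (intro integral_mono Q_dev_int)
    fix u
    have "norm (Q (Fp u - \<Psi> v)) \<le> \<delta> + sqrt \<alpha> * V (u - v)"
      using Fp_error_Q[of u v] by (simp add: projBV_id[OF v])
    also have "\<dots> \<le> \<delta> + sqrt \<alpha> * (V (m - v) + V (u - m))"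
      using Vnorm_triangle[of "m - v" "u - m"] \<alpha> by (intro add_left_mono mult_left_mono) auto
    finally show "norm (Q (Fp u - \<Psi> v)) \<le> \<delta> + sqrt \<alpha> * (V (m - v) + V (u - m))" .
  qed (use Vi in auto)
  also have "\<dots> = \<delta> + sqrt \<alpha> * (V (m - v) + (\<integral>u. V (u - m) \<partial>G))"
    using Vi by (simp add: prob_space)
  also have "\<dots> \<le> \<delta> + sqrt \<alpha> * (V (m - v) + sqrt (\<integral>u. (V (u - m))\<^sup>2 \<partial>G))"
    using Vi(2) \<alpha> by (intro add_left_mono mult_left_mono) auto
  finally show ?thesis .
qed

end

section \<open>Error recursion and conclusion\<close>

text \<open>The majorant \<open>W\<close> is hidden, as it depends on the run. It starts at
  \<open>Suc N\<close>, one update after the truth is in the ball, when the current Gaussian is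
  known to have a finite second moment.\<close>

definition obeys_recursion ::
    "real \<Rightarrow> real \<Rightarrow> real \<Rightarrow> real \<Rightarrow> nat \<Rightarrow> (nat \<Rightarrow> real) \<Rightarrow> (nat \<Rightarrow> real) \<Rightarrow> bool" where
  "obeys_recursion q c0 b d N g e \<longleftrightarrow> (\<exists>W. (\<forall>j. e j \<le> W j) \<and> W (Suc N) \<le> c0 + d * g (Suc N) \<and>
     (\<forall>j>N. W (Suc j) \<le> q * W j + (b + d * g (Suc j))))"

text \<open>The order of quantifiers carries the uniformity: \<open>c\<close> and \<open>q\<close>
  are fixed before the map, \<open>\<epsilon>\<close>, \<open>\<delta>\<close> and the noise. Only
  the transient \<open>c0\<close> may depend on \<open>\<epsilon>\<close>.\<close>

lemma gpf_error_recursion: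
  fixes H :: "'a::{real_inner,polish_space} \<Rightarrow> real^'k" and Ha :: "real^'k \<Rightarrow> 'a"
    and \<beta> r \<alpha> \<kappa> a :: real and R :: "real^'k^'k"
  assumes par: "0 \<le> \<beta>" "0 < r" "0 < \<alpha>" "\<alpha> < 1" "0 \<le> \<kappa>" "0 < a"
    and R_nonneg: "\<And>x. 0 \<le> x \<bullet> (R *v x)"
  obtains c q c0 where "0 \<le> c" "0 \<le> q" "q < 1" "\<And>\<epsilon>::real. 0 < \<epsilon> \<Longrightarrow> 0 \<le> c0 \<epsilon>"
    "\<And>\<Psi> F \<delta> \<Lambda> \<epsilon> u \<eta> m0 C0 G m C N.
      gpf_setting H Ha \<beta> \<Psi> F r \<alpha> \<kappa> \<delta> \<Lambda> a \<epsilon> R \<Longrightarrow>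
      gpf_run H Ha R \<epsilon> a r \<beta> F (\<lambda>j. H (u j) + \<epsilon> *\<^sub>R \<eta> j) m0 C0 G m C \<Longrightarrow>
      (\<And>j. u (Suc j) = \<Psi> (u j)) \<Longrightarrow> (\<And>j. N \<le> j \<Longrightarrow> norm (u j) \<le> r) \<Longrightarrow>
      obeys_recursion q (c0 \<epsilon>) (c * (\<epsilon> + \<delta>)) (c * \<epsilon>) N (\<lambda>j. norm (\<eta> j)) (\<lambda>j. norm (m j - u j))"
proof -
  obtain K where K: "\<And>z. norm (R *v z) \<le> K * norm z"
    using linear_bounded[OF matrix_vector_mul_linear[of R]] by blast
  have K0: "0 \<le> K"
    using order_trans[OF norm_ge_zero K[of "axis undefined 1"]] by (simp add: norm_axis_1)
  define \<rho> where "\<rho> = r + \<kappa>"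
  define s where "s = sqrt \<alpha>"
  \<comment> \<open>The midpoint of \<open>s\<close> and \<open>1\<close>; the gap
    \<open>q - s\<close> pays for the effect of the spread on the mean error.\<close>
  define q where "q = (1 + s) / 2"
  define b where "b = sqrt (1 + \<beta>)"
  define k1 where "k1 = K / a + 1 + (4 * \<rho>\<^sup>2 + a) / a"
  define k2 where "k2 = 4 * \<rho>\<^sup>2 / a"
  define k3 where "k3 = sqrt ((1 + \<beta>) * (\<Sum>b\<in>Basis. b \<bullet> (R *v b)))"
  \<comment> \<open>\<open>w1\<close> makes the coefficient of the spread exactly
    \<open>q * w1\<close>. \<open>w2\<close> need only absorb the old observed error, since the new
    one is bounded in terms of \<open>\<epsilon>\<close> and the noise alone.\<close>
  define w1 where "w1 = (1 + k2) * s / (q - s)"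
  define w2 where "w2 = b / q"
  define c where "c = (1 + k2 + w1) + (w1 * k3 + w2 * (k1 * (2 * \<rho>))) + (k2 + w2 * k1)"
  have s: "0 < s" "s < 1" using par by (auto simp: s_def)
  have q: "s < q" "0 < q" "q < 1" using s by (auto simp: q_def)
  have b: "1 \<le> b" using par by (simp add: b_def)
  have \<rho>: "0 < \<rho>" using par by (simp add: \<rho>_def)
  have k: "0 \<le> k1" "0 \<le> k2" using K0 par by (auto simp: k1_def k2_def)
  have k3: "0 \<le> k3" using par by (auto simp: k3_def intro!: mult_nonneg_nonneg sum_nonneg R_nonneg)
  have w1: "0 \<le> w1" "(1 + k2) * s + w1 * s = q * w1"
    using q s k by (auto simp: w1_def field_simps)
  have w2: "1 \<le> w2" "s * b \<le> q * w2"
    using q s b by (auto simp: w2_def field_simps mult_left_le_one_le)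
  have c: "0 \<le> c" using k k3 w1 w2 \<rho> by (auto simp: c_def)
  define c0 where
    "c0 \<epsilon> = 2 * \<rho> + k2 * (2 * \<rho>) + w1 * (2 * \<rho> + \<epsilon> * k3) + w2 * (\<epsilon> * k1 * (2 * \<rho>))" for \<epsilon>
  have c0: "0 \<le> c0 \<epsilon>" if "0 < \<epsilon>" for \<epsilon>
    using k k3 w1 w2 \<rho> that by (simp add: c0_def)
  have "obeys_recursion q (c0 \<epsilon>) (c * (\<epsilon> + \<delta>)) (c * \<epsilon>) N (\<lambda>j. norm (\<eta> j)) (\<lambda>j. norm (m j - u j))"
    if setting: "gpf_setting H Ha \<beta> \<Psi> F r \<alpha> \<kappa> \<delta> \<Lambda> a \<epsilon> R"
      and run: "gpf_run H Ha R \<epsilon> a r \<beta> F (\<lambda>j. H (u j) + \<epsilon> *\<^sub>R \<eta> j) m0 C0 G m C"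
      and u: "\<And>j. u (Suc j) = \<Psi> (u j)" and uN: "\<And>j. N \<le> j \<Longrightarrow> norm (u j) \<le> r"
    for \<Psi> F \<delta> \<Lambda> \<epsilon> u \<eta> m0 C0 G m C N
  proof -
    interpret gpf_setting H Ha \<beta> \<Psi> F r \<alpha> \<kappa> \<delta> \<Lambda> a \<epsilon> R by (fact setting)
    note \<epsilon> = \<epsilon>_pos'
    \<comment> \<open>The index is shifted because \<open>G (Suc j)\<close> is the Gaussian with
      mean \<open>m j\<close>.\<close>
    define t where "t j = sqrt (\<integral>v. (V (v - m j))\<^sup>2 \<partial>G (Suc j))" for j
    define x where "x j = norm (Q (m j - u j))" for j
    define p where "p j = norm (H (m j - u j))" for j
    define W where "W j = x j + w1 * t j + w2 * p j" for j
    have pos: "0 \<le> x j" "0 \<le> t j" "0 \<le> p j" for j by (auto simp: t_def x_def p_def)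
    have gauss: "is_gaussian (G (Suc j)) (m j) (C j)" for j
      using run by (auto simp: gpf_run_def Let_def dest: spec[of _ "Suc j"])
    have step: "gpf_step H Ha \<beta> \<Psi> F r \<alpha> \<kappa> \<delta> \<Lambda> a \<epsilon> R (G (Suc j))" for j
      using gauss[of j] setting
      by (intro gpf_step.intro gpf_step_axioms.intro) (auto simp: is_gaussian_def)
    \<comment> \<open>\<open>D\<close> is the forecast spread and \<open>e\<close> the unobserved
      forecast error. Their bounds by \<open>2 * \<rho>\<close> always hold; the contracting ones
      presuppose a second moment, which each update provides for the next.\<close>
    have update: "\<exists>D e. 0 \<le> D \<and> D \<le> 2 * \<rho>
        \<and> p (Suc j) \<le> \<epsilon> * k1 * (2 * \<rho> + norm (\<eta> (Suc j)))
        \<and> x (Suc j) \<le> e + k2 * D + k2 * (\<epsilon> * norm (\<eta> (Suc j)))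
        \<and> t (Suc j) \<le> D + \<epsilon> * k3
        \<and> integrable (G (Suc (Suc j))) (\<lambda>v. (V (v - m (Suc j)))\<^sup>2)
        \<and> e \<le> 2 * \<rho>
        \<and> (integrable (G (Suc j)) (\<lambda>v. (V (v - m j))\<^sup>2) \<longrightarrow>
            D \<le> \<delta> + s * t j \<and> e \<le> \<delta> + s * (V (m j - u j) + t j))"
      if j: "N \<le> j" for j
    proof -
      interpret step: gpf_step H Ha \<beta> \<Psi> F r \<alpha> \<kappa> \<delta> \<Lambda> a \<epsilon> R "G (Suc j)" by (rule step)
      have uj: "norm (u j) \<le> r" and uSj: "norm (u (Suc j)) \<le> r" using uN j by auto
      have m: "m (Suc j) = step.mean_update (u (Suc j)) (\<eta> (Suc j))"
        and C: "C (Suc j) = step.posterior"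
        using run
        by (auto simp: gpf_run_def Let_def step.mean_def step.cov_def step.S_def
            dest: spec[of _ "Suc j"])
      have G': "is_gaussian (G (Suc (Suc j))) (m (Suc j)) step.posterior"
        using gauss[of "Suc j"] by (simp add: C)
      have "norm (Q (step.mean - u (Suc j))) \<le> 2 * \<rho>"
        using order_trans[OF norm_Q_le step.norm_truth_diff[OF uSj]]
        by (simp add: H_simps Ha_simps norm_minus_commute \<rho>_def algebra_simps)
      then show ?thesis
        using step.spread_nonneg step.spread_le_bound step.update_error_H[OF uSj K, of "\<eta> (Suc j)"]
          step.update_error_Q[OF uSj, of "\<eta> (Suc j)"] step.posterior_spread[OF G']
          step.spread_le[of "m j"] step.forecast_error_Q[OF uj, of "m j"] u
        unfolding x_def p_def t_def m k1_def k2_def k3_def \<rho>_def s_def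
        by (intro exI[of _ step.spread] exI[of _ "norm (Q (step.mean - u (Suc j)))"]) auto
    qed
    have "W (Suc N) \<le> c0 \<epsilon> + c * \<epsilon> * norm (\<eta> (Suc N))"
    proof -
      obtain D e where *: "D \<le> 2 * \<rho>" "e \<le> 2 * \<rho>"
        "p (Suc N) \<le> \<epsilon> * k1 * (2 * \<rho> + norm (\<eta> (Suc N)))"
        "x (Suc N) \<le> e + k2 * D + k2 * (\<epsilon> * norm (\<eta> (Suc N)))"
        "t (Suc N) \<le> D + \<epsilon> * k3"
        using update[of N] by auto
      have "W (Suc N) \<le> (2 * \<rho> + k2 * (2 * \<rho>) + k2 * (\<epsilon> * norm (\<eta> (Suc N))))
          + w1 * (2 * \<rho> + \<epsilon> * k3) + w2 * (\<epsilon> * k1 * (2 * \<rho> + norm (\<eta> (Suc N))))"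
        unfolding W_def
      proof (intro add_mono mult_left_mono)
        show "x (Suc N) \<le> 2 * \<rho> + k2 * (2 * \<rho>) + k2 * (\<epsilon> * norm (\<eta> (Suc N)))"
          using *(2,4) mult_left_mono[OF *(1) k(2)] by linarith
      qed (use * w1 w2 in auto)
      also have "\<dots> = c0 \<epsilon> + (k2 + w2 * k1) * (\<epsilon> * norm (\<eta> (Suc N)))"
        by (simp add: c0_def algebra_simps)
      also have "\<dots> \<le> c0 \<epsilon> + c * (\<epsilon> * norm (\<eta> (Suc N)))"
        using k k3 w1 w2 \<rho> \<epsilon> by (intro add_left_mono mult_right_mono) (auto simp: c_def)
      finally show ?thesis by (simp add: mult.assoc)
    qed
    moreover have "W (Suc j) \<le> q * W j + (c * (\<epsilon> + \<delta>) + c * \<epsilon> * norm (\<eta> (Suc j)))"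
      if j: "N < j" for j
    proof -
      \<comment> \<open>As \<open>j > N\<close>, the preceding update supplies the second
        moment.\<close>
      have "integrable (G (Suc j)) (\<lambda>v. (V (v - m j))\<^sup>2)"
      proof -
        obtain i where "j = Suc i" "N \<le> i" using j by (cases j) auto
        then show ?thesis using update[of i] by blast
      qed
      then obtain D e where *: "D \<le> \<delta> + s * t j" "e \<le> \<delta> + s * (V (m j - u j) + t j)"
        "p (Suc j) \<le> \<epsilon> * k1 * (2 * \<rho> + norm (\<eta> (Suc j)))"
        "x (Suc j) \<le> e + k2 * D + k2 * (\<epsilon> * norm (\<eta> (Suc j)))"
        "t (Suc j) \<le> D + \<epsilon> * k3"
        using update[of j] j by auto
      define n where "n = \<epsilon> * norm (\<eta> (Suc j))"
      have n: "0 \<le> n" using \<epsilon> by (simp add: n_def)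
      have Vj: "V (m j - u j) \<le> x j + b * p j"
        using Vnorm_le_Q_H[of "m j - u j"] by (simp add: x_def p_def b_def)
      have e: "e \<le> \<delta> + s * (x j + b * p j + t j)"
        using *(2) mult_left_mono[OF Vj less_imp_le[OF s(1)]] by (simp add: distrib_left)
      have "x (Suc j) \<le> \<delta> + s * (x j + b * p j + t j) + k2 * (\<delta> + s * t j) + k2 * n"
        using *(4) e mult_left_mono[OF *(1) k(2)] unfolding n_def by linarith
      moreover have "w1 * t (Suc j) \<le> w1 * (\<delta> + s * t j + \<epsilon> * k3)"
        using *(1,5) w1 by (intro mult_left_mono) auto
      moreover have "w2 * p (Suc j) \<le> w2 * (\<epsilon> * k1 * (2 * \<rho> + norm (\<eta> (Suc j))))"
        using *(3) w2 by (intro mult_left_mono) auto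
      ultimately have "W (Suc j) \<le> (\<delta> + s * (x j + b * p j + t j) + k2 * (\<delta> + s * t j) + k2 * n)
          + w1 * (\<delta> + s * t j + \<epsilon> * k3) + w2 * (\<epsilon> * k1 * (2 * \<rho> + norm (\<eta> (Suc j))))"
        unfolding W_def by linarith
      also have "\<dots> = (s * x j + ((1 + k2) * s + w1 * s) * t j + s * b * p j)
          + ((1 + k2 + w1) * \<delta> + (w1 * k3 + w2 * (k1 * (2 * \<rho>))) * \<epsilon> + (k2 + w2 * k1) * n)"
        by (simp add: n_def algebra_simps)
      also have "\<dots> \<le> (q * x j + q * w1 * t j + q * w2 * p j)
          + (c * \<delta> + c * \<epsilon> + c * n)"
        unfolding w1(2)
        using q w2(2) pos[of j] k k3 w1 w2 \<rho> \<epsilon> \<delta>_nonneg n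
        by (intro add_mono mult_right_mono) (auto simp: c_def)
      also have "\<dots> = q * W j + (c * (\<epsilon> + \<delta>) + c * \<epsilon> * norm (\<eta> (Suc j)))"
        by (simp add: W_def n_def algebra_simps)
      finally show ?thesis .
    qed
    moreover have "norm (m j - u j) \<le> W j" for j
    proof -
      have "p j \<le> w2 * p j" using mult_right_mono[OF w2(1) pos(3)[of j]] by simp
      moreover have "0 \<le> w1 * t j" using w1 pos by simp
      ultimately show ?thesis
        using norm_le_Q_H[of "m j - u j"] by (simp add: W_def x_def p_def)
    qed
    ultimately show ?thesis unfolding obeys_recursion_def by (intro exI[of _ W]) blast
  qed
  with c q c0 show ?thesis by (intro that[of c q c0]) auto
qed

section \<open>Comparison of the two filters through the truth\<close>

theorem theorem4p2:
  fixes H :: "'a::{real_inner,polish_space} \<Rightarrow> real^'k"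
    and Ha :: "real^'k \<Rightarrow> 'a"
    and \<Psi> :: "'a \<Rightarrow> 'a"
    and r \<beta> L \<alpha> \<kappa> Ls :: real
    and R :: "real^'k^'k"
    and u0 m0 :: 'a and C0 :: "'a \<Rightarrow> 'a"
    and \<Omega> :: "'w measure" and \<eta> :: "nat \<Rightarrow> 'w \<Rightarrow> real^'k"
  defines "P \<equiv> (\<lambda>x. Ha (H x))"
  assumes H_lin: "bounded_linear H"
    and H_adj: "\<And>u z. Ha z \<bullet> u = z \<bullet> H u"
    and H_coiso: "\<And>z. H (Ha z) = z"
    \<comment> \<open>Assumption A\<close>
    and A_par: "r > 0" "\<beta> \<ge> 0" "L > 0" "0 < \<alpha>" "\<alpha> < 1"
    and A_absorb: "\<And>u. \<exists>n. \<forall>j\<ge>n. norm ((\<Psi> ^^ j) u) \<le> r"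
    and A_inv: "\<And>u. norm u \<le> r \<Longrightarrow> norm (\<Psi> u) \<le> r"
    and A_lip: "\<And>u v. norm u \<le> r \<Longrightarrow> norm v \<le> r \<Longrightarrow>
          (Vnorm P \<beta> (\<Psi> u - \<Psi> v))\<^sup>2 \<le> L * (Vnorm P \<beta> (u - v))\<^sup>2"
    and A_contr: "\<And>u v. norm u \<le> r \<Longrightarrow> norm v \<le> r \<Longrightarrow>
          (Vnorm P \<beta> ((\<Psi> u - \<Psi> v) - P (\<Psi> u - \<Psi> v)))\<^sup>2 \<le> \<alpha> * (Vnorm P \<beta> (u - v))\<^sup>2"
    \<comment> \<open>constants of Assumption B\<close>
    and B_par: "\<kappa> > 0" "Ls > 0"
    \<comment> \<open>observation noise: independent, mean zero, covariance R\<close>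
    and noise_prob: "prob_space \<Omega>"
    and noise_meas: "\<And>j. j \<ge> 1 \<Longrightarrow> \<eta> j \<in> borel_measurable \<Omega>"
    and noise_indep: "prob_space.indep_vars \<Omega> (\<lambda>_. borel) \<eta> {1..}"
    and noise_int: "\<And>j. j \<ge> 1 \<Longrightarrow> integrable \<Omega> (\<lambda>\<omega>. (norm (\<eta> j \<omega>))\<^sup>2)"
    and noise_mean: "\<And>j. j \<ge> 1 \<Longrightarrow> (\<integral>\<omega>. \<eta> j \<omega> \<partial>\<Omega>) = 0"
    and noise_cov: "\<And>j b c. j \<ge> 1 \<Longrightarrow>
          (\<integral>\<omega>. (b \<bullet> \<eta> j \<omega>) * (c \<bullet> \<eta> j \<omega>) \<partial>\<Omega>) = b \<bullet> (R *v c)"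
  shows "\<exists>a0. \<forall>a>a0. \<exists>C3. \<forall>\<epsilon> \<delta> \<Psi>s m C G ms Cs Gs.
     \<epsilon> > 0 \<longrightarrow> \<delta> > 0 \<longrightarrow>
     \<comment> \<open>Assumption B on the surrogate with this \<delta>\<close>
     (\<forall>u. norm u \<le> r \<longrightarrow> norm (\<Psi>s u - \<Psi> u) \<le> \<kappa>) \<longrightarrow>
     (\<forall>u. norm u \<le> r \<longrightarrow>
        norm ((\<Psi>s u - \<Psi> u) - P (\<Psi>s u - \<Psi> u)) \<le> \<delta>) \<longrightarrow>
     (\<forall>u v. norm u \<le> r \<longrightarrow> norm v \<le> r \<longrightarrow>
        (Vnorm P \<beta> (\<Psi>s u - \<Psi>s v))\<^sup>2 \<le> Ls * (Vnorm P \<beta> (u - v))\<^sup>2) \<longrightarrow>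
     \<comment> \<open>GPF and GPF-s driven by the observations y_j = H u_j + \<epsilon> \<eta>_j\<close>
     (\<forall>\<omega>\<in>space \<Omega>.
        gpf_run H Ha R \<epsilon> a r \<beta> \<Psi>
          (\<lambda>j. H ((\<Psi> ^^ j) u0) + \<epsilon> *\<^sub>R \<eta> j \<omega>) m0 C0 (G \<omega>) (m \<omega>) (C \<omega>)) \<longrightarrow>
     (\<forall>\<omega>\<in>space \<Omega>.
        gpf_run H Ha R \<epsilon> a r \<beta> \<Psi>s
          (\<lambda>j. H ((\<Psi> ^^ j) u0) + \<epsilon> *\<^sub>R \<eta> j \<omega>) m0 C0 (Gs \<omega>) (ms \<omega>) (Cs \<omega>)) \<longrightarrow>
     limsup (\<lambda>j. \<integral>\<^sup>+\<omega>. ennreal (norm (m \<omega> j - ms \<omega> j)) \<partial>\<Omega>)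
       \<le> ennreal (C3 * (\<epsilon> + \<delta>))"
proof -
  interpret \<Omega>: prob_space \<Omega> by (fact noise_prob)
  \<comment> \<open>Symmetry and nonnegativity of \<open>R\<close> are read off from the covariance
    of \<open>\<eta> 1\<close>.\<close>
  have R_symmetric: "x \<bullet> (R *v y) = y \<bullet> (R *v x)" for x y
    using noise_cov[of 1 x y] noise_cov[of 1 y x] by (simp add: mult.commute)
  have R_nonneg: "0 \<le> x \<bullet> (R *v x)" for x
    using noise_cov[of 1 x x] by (metis (no_types, lifting) Bochner_Integration.integral_nonneg order_refl zero_le_square)
  \<comment> \<open>The trace of \<open>R\<close> is the mean square of the noise norm at each time,
    so \<open>K\<close> bounds its mean.\<close>
  define K where "K = sqrt (\<Sum>b\<in>Basis. b \<bullet> (R *v b))"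
  have noise: "integrable \<Omega> (\<lambda>\<omega>. norm (\<eta> j \<omega>))" "(\<integral>\<omega>. norm (\<eta> j \<omega>) \<partial>\<Omega>) \<le> K" if j: "j \<ge> 1" for j
  proof -
    have [measurable]: "\<eta> j \<in> borel_measurable \<Omega>" by (rule noise_meas[OF j])
    have nm: "(\<lambda>\<omega>. norm (\<eta> j \<omega>)) \<in> borel_measurable \<Omega>" by measurable
    show "integrable \<Omega> (\<lambda>\<omega>. norm (\<eta> j \<omega>))"
      by (rule \<Omega>.integral_le_sqrt_integral_square(1)[OF nm noise_int[OF j]])
    have sq: "integrable \<Omega> (\<lambda>\<omega>. (b \<bullet> \<eta> j \<omega>) * (b \<bullet> \<eta> j \<omega>))" if "b \<in> Basis" for b
    proof (rule Bochner_Integration.integrable_bound[OF noise_int[OF j]])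
      show "AE \<omega> in \<Omega>. norm ((b \<bullet> \<eta> j \<omega>) * (b \<bullet> \<eta> j \<omega>)) \<le> norm ((norm (\<eta> j \<omega>))\<^sup>2)"
        using power_mono[OF Basis_le_norm[OF that] abs_ge_zero, of _ 2]
        by (intro AE_I2) (simp add: inner_commute[of b] power2_eq_square)
    qed measurable
    have "(\<integral>\<omega>. (norm (\<eta> j \<omega>))\<^sup>2 \<partial>\<Omega>) = (\<integral>\<omega>. (\<Sum>b\<in>Basis. (b \<bullet> \<eta> j \<omega>) * (b \<bullet> \<eta> j \<omega>)) \<partial>\<Omega>)"
      unfolding power2_norm_eq_inner euclidean_inner[of "\<eta> j _" "\<eta> j _"]
      by (simp add: inner_commute)
    also have "\<dots> = (\<Sum>b\<in>Basis. b \<bullet> (R *v b))"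
      using sq by (simp add: noise_cov[OF j])
    finally show "(\<integral>\<omega>. norm (\<eta> j \<omega>) \<partial>\<Omega>) \<le> K"
      using \<Omega>.integral_le_sqrt_integral_square(2)[OF nm noise_int[OF j]] by (simp add: K_def)
  qed
  \<comment> \<open>The truth is deterministic, so its entry time into the ball is the same for all
    sample points and all \<open>\<epsilon>\<close>.\<close>
  obtain N where N: "\<forall>j\<ge>N. norm ((\<Psi> ^^ j) u0) \<le> r" using A_absorb by blast
  \<comment> \<open>The threshold \<open>a0\<close> is taken to be \<open>0\<close>: the size of
    \<open>a\<close> affects the constant, while the contraction factor comes from
    \<open>\<alpha>\<close>.\<close>
  have "\<exists>C3. \<forall>\<epsilon> \<delta> \<Psi>s m C G ms Cs Gs. \<epsilon> > 0 \<longrightarrow> \<delta> > 0 \<longrightarrow>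
     (\<forall>u. norm u \<le> r \<longrightarrow> norm (\<Psi>s u - \<Psi> u) \<le> \<kappa>) \<longrightarrow>
     (\<forall>u. norm u \<le> r \<longrightarrow> norm ((\<Psi>s u - \<Psi> u) - P (\<Psi>s u - \<Psi> u)) \<le> \<delta>) \<longrightarrow>
     (\<forall>u v. norm u \<le> r \<longrightarrow> norm v \<le> r \<longrightarrow>
        (Vnorm P \<beta> (\<Psi>s u - \<Psi>s v))\<^sup>2 \<le> Ls * (Vnorm P \<beta> (u - v))\<^sup>2) \<longrightarrow>
     (\<forall>\<omega>\<in>space \<Omega>. gpf_run H Ha R \<epsilon> a r \<beta> \<Psi>
          (\<lambda>j. H ((\<Psi> ^^ j) u0) + \<epsilon> *\<^sub>R \<eta> j \<omega>) m0 C0 (G \<omega>) (m \<omega>) (C \<omega>)) \<longrightarrow>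
     (\<forall>\<omega>\<in>space \<Omega>. gpf_run H Ha R \<epsilon> a r \<beta> \<Psi>s
          (\<lambda>j. H ((\<Psi> ^^ j) u0) + \<epsilon> *\<^sub>R \<eta> j \<omega>) m0 C0 (Gs \<omega>) (ms \<omega>) (Cs \<omega>)) \<longrightarrow>
     limsup (\<lambda>j. \<integral>\<^sup>+\<omega>. ennreal (norm (m \<omega> j - ms \<omega> j)) \<partial>\<Omega>) \<le> ennreal (C3 * (\<epsilon> + \<delta>))"
    if a: "a > 0" for a
  proof (rule gpf_error_recursion[where H = H and Ha = Ha, OF A_par(2,1,4,5) less_imp_le[OF B_par(1)] a R_nonneg])
    fix c q :: real and c0 :: "real \<Rightarrow> real"
    assume c: "0 \<le> c" and q: "0 \<le> q" "q < 1"
      and c0: "\<And>\<epsilon>::real. 0 < \<epsilon> \<Longrightarrow> 0 \<le> c0 \<epsilon>"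
      and rec: "\<And>\<Psi> F \<delta> \<Lambda> \<epsilon> u \<eta> m0 C0 G m C N.
        gpf_setting H Ha \<beta> \<Psi> F r \<alpha> \<kappa> \<delta> \<Lambda> a \<epsilon> R \<Longrightarrow>
        gpf_run H Ha R \<epsilon> a r \<beta> F (\<lambda>j. H (u j) + \<epsilon> *\<^sub>R \<eta> j) m0 C0 G m C \<Longrightarrow>
        (\<And>j. u (Suc j) = \<Psi> (u j)) \<Longrightarrow> (\<And>j. N \<le> j \<Longrightarrow> norm (u j) \<le> r) \<Longrightarrow>
        obeys_recursion q (c0 \<epsilon>) (c * (\<epsilon> + \<delta>)) (c * \<epsilon>) N (\<lambda>j. norm (\<eta> j)) (\<lambda>j. norm (m j - u j))"
    have "limsup (\<lambda>j. \<integral>\<^sup>+\<omega>. ennreal (norm (m \<omega> j - ms \<omega> j)) \<partial>\<Omega>)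
        \<le> ennreal ((2 * c + 2 * c * K) / (1 - q) * (\<epsilon> + \<delta>))"
      if \<epsilon>: "\<epsilon> > 0" and \<delta>: "\<delta> > 0"
        and B1: "\<forall>u. norm u \<le> r \<longrightarrow> norm (\<Psi>s u - \<Psi> u) \<le> \<kappa>"
        and B2: "\<forall>u. norm u \<le> r \<longrightarrow> norm ((\<Psi>s u - \<Psi> u) - P (\<Psi>s u - \<Psi> u)) \<le> \<delta>"
        and B3: "\<forall>u v. norm u \<le> r \<longrightarrow> norm v \<le> r \<longrightarrow>
          (Vnorm P \<beta> (\<Psi>s u - \<Psi>s v))\<^sup>2 \<le> Ls * (Vnorm P \<beta> (u - v))\<^sup>2"
        and run: "\<forall>\<omega>\<in>space \<Omega>. gpf_run H Ha R \<epsilon> a r \<beta> \<Psi>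
          (\<lambda>j. H ((\<Psi> ^^ j) u0) + \<epsilon> *\<^sub>R \<eta> j \<omega>) m0 C0 (G \<omega>) (m \<omega>) (C \<omega>)"
        and runs: "\<forall>\<omega>\<in>space \<Omega>. gpf_run H Ha R \<epsilon> a r \<beta> \<Psi>s
          (\<lambda>j. H ((\<Psi> ^^ j) u0) + \<epsilon> *\<^sub>R \<eta> j \<omega>) m0 C0 (Gs \<omega>) (ms \<omega>) (Cs \<omega>)"
      for \<epsilon> \<delta> \<Psi>s m C G ms Cs Gs
    proof -
      interpret weighted_coisometry H Ha \<beta>
        by (rule weighted_coisometry.intro[OF H_lin H_adj H_coiso A_par(2)])
      have set_s: "gpf_setting H Ha \<beta> \<Psi> \<Psi>s r \<alpha> \<kappa> \<delta> Ls a \<epsilon> R"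
        using A_par A_inv A_contr B_par B1 B2 B3 \<delta> \<epsilon> a R_symmetric R_nonneg unfolding P_def
        by (intro gpf_setting.intro gpf_setting_axioms.intro weighted_coisometry_axioms) auto
      \<comment> \<open>The exact filter has zero model error, so it fits the same setting with the
        same \<open>\<kappa>\<close> and \<open>\<delta>\<close>.\<close>
      have set: "gpf_setting H Ha \<beta> \<Psi> \<Psi> r \<alpha> \<kappa> \<delta> L a \<epsilon> R"
        using A_par A_inv A_contr A_lip B_par \<delta> \<epsilon> a R_symmetric R_nonneg unfolding P_def
        by (intro gpf_setting.intro gpf_setting_axioms.intro weighted_coisometry_axioms)
           (auto simp: H_simps Ha_simps)
      \<comment> \<open>Majorants are chosen for each sample point separately, without
        measurability, as \<open>limsup_expectation_contractive_recursion\<close> permits.\<close>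
      have "\<exists>W. (\<forall>j. norm (m \<omega> j - (\<Psi> ^^ j) u0) \<le> W j) \<and>
            W (Suc N) \<le> c0 \<epsilon> + c * \<epsilon> * norm (\<eta> (Suc N) \<omega>) \<and>
            (\<forall>j>N. W (Suc j) \<le> q * W j + (c * (\<epsilon> + \<delta>) + c * \<epsilon> * norm (\<eta> (Suc j) \<omega>)))"
        if "\<omega> \<in> space \<Omega>" for \<omega>
        using rec[OF set bspec[OF run that], of N] N unfolding obeys_recursion_def by simp
      then obtain W where W: "\<And>\<omega>. \<omega> \<in> space \<Omega> \<Longrightarrow> (\<forall>j. norm (m \<omega> j - (\<Psi> ^^ j) u0) \<le> W \<omega> j) \<and>
            W \<omega> (Suc N) \<le> c0 \<epsilon> + c * \<epsilon> * norm (\<eta> (Suc N) \<omega>) \<and>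
            (\<forall>j>N. W \<omega> (Suc j) \<le> q * W \<omega> j + (c * (\<epsilon> + \<delta>) + c * \<epsilon> * norm (\<eta> (Suc j) \<omega>)))"
        by metis
      have "\<exists>W. (\<forall>j. norm (ms \<omega> j - (\<Psi> ^^ j) u0) \<le> W j) \<and>
            W (Suc N) \<le> c0 \<epsilon> + c * \<epsilon> * norm (\<eta> (Suc N) \<omega>) \<and>
            (\<forall>j>N. W (Suc j) \<le> q * W j + (c * (\<epsilon> + \<delta>) + c * \<epsilon> * norm (\<eta> (Suc j) \<omega>)))"
        if "\<omega> \<in> space \<Omega>" for \<omega>
        using rec[OF set_s bspec[OF runs that], of N] N unfolding obeys_recursion_def by simp
      then obtain Ws where Ws: "\<And>\<omega>. \<omega> \<in> space \<Omega> \<Longrightarrow> (\<forall>j. norm (ms \<omega> j - (\<Psi> ^^ j) u0) \<le> Ws \<omega> j) \<and>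
            Ws \<omega> (Suc N) \<le> c0 \<epsilon> + c * \<epsilon> * norm (\<eta> (Suc N) \<omega>) \<and>
            (\<forall>j>N. Ws \<omega> (Suc j) \<le> q * Ws \<omega> j + (c * (\<epsilon> + \<delta>) + c * \<epsilon> * norm (\<eta> (Suc j) \<omega>)))"
        by metis
      \<comment> \<open>By the triangle inequality through the truth, the sum of both majorants
        bounds the distance of the means; \<open>Z 0\<close> sits at time \<open>Suc N\<close>, a
        shift that the limsup ignores.\<close>
      define Z where "Z k \<omega> = W \<omega> (Suc (k + N)) + Ws \<omega> (Suc (k + N))" for k \<omega>
      have "limsup (\<lambda>j. \<integral>\<^sup>+\<omega>. ennreal (norm (m \<omega> j - ms \<omega> j)) \<partial>\<Omega>)
          = limsup (\<lambda>k. \<integral>\<^sup>+\<omega>. ennreal (norm (m \<omega> (k + Suc N) - ms \<omega> (k + Suc N))) \<partial>\<Omega>)"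
        by (rule limsup_shift_k[symmetric])
      also have "\<dots> \<le> limsup (\<lambda>k. \<integral>\<^sup>+\<omega>. ennreal (Z k \<omega>) \<partial>\<Omega>)"
      proof (intro Limsup_mono always_eventually allI nn_integral_mono ennreal_leI)
        fix k \<omega> assume "\<omega> \<in> space \<Omega>"
        then show "norm (m \<omega> (k + Suc N) - ms \<omega> (k + Suc N)) \<le> Z k \<omega>"
          using W[of \<omega>] Ws[of \<omega>]
            norm_triangle_ineq4[of "m \<omega> (Suc (k + N)) - (\<Psi> ^^ Suc (k + N)) u0" "ms \<omega> (Suc (k + N)) - (\<Psi> ^^ Suc (k + N)) u0"]
          unfolding Z_def add_Suc_right by (smt (verit) diff_diff_eq2 diff_add_cancel)
      qed
      also have "\<dots> \<le> ennreal ((2 * c * (\<epsilon> + \<delta>) + 2 * c * \<epsilon> * K) / (1 - q))"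
      proof (rule limsup_expectation_contractive_recursion[where g = "\<lambda>k \<omega>. norm (\<eta> (Suc (k + N)) \<omega>)"
            and ?c0.0 = "2 * c0 \<epsilon>"])
        show "Z 0 \<omega> \<le> 2 * c0 \<epsilon> + 2 * c * \<epsilon> * norm (\<eta> (Suc (0 + N)) \<omega>)" if "\<omega> \<in> space \<Omega>" for \<omega>
          using W[OF that] Ws[OF that] by (simp add: Z_def)
        show "Z (Suc k) \<omega> \<le> q * Z k \<omega> + (2 * c * (\<epsilon> + \<delta>) + 2 * c * \<epsilon> * norm (\<eta> (Suc (Suc k + N)) \<omega>))"
          if "\<omega> \<in> space \<Omega>" for k \<omega>
        proof -
          have "W \<omega> (Suc (Suc (k + N))) \<le> q * W \<omega> (Suc (k + N)) + (c * (\<epsilon> + \<delta>) + c * \<epsilon> * norm (\<eta> (Suc (Suc (k + N))) \<omega>))"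
            "Ws \<omega> (Suc (Suc (k + N))) \<le> q * Ws \<omega> (Suc (k + N)) + (c * (\<epsilon> + \<delta>) + c * \<epsilon> * norm (\<eta> (Suc (Suc (k + N))) \<omega>))"
            using W[OF that] Ws[OF that] by simp_all
          then show ?thesis by (simp add: Z_def distrib_left)
        qed
      qed (use c0 c \<epsilon> \<delta> q noise noise_prob in auto)
      also have "\<dots> \<le> ennreal ((2 * c + 2 * c * K) / (1 - q) * (\<epsilon> + \<delta>))"
      proof (rule ennreal_leI)
        have "0 \<le> K" unfolding K_def by (simp add: sum_nonneg R_nonneg)
        then have "2 * c * \<epsilon> * K \<le> 2 * c * K * (\<epsilon> + \<delta>)"
          using c \<delta> by (simp add: algebra_simps)
        then have "2 * c * (\<epsilon> + \<delta>) + 2 * c * \<epsilon> * K \<le> (2 * c + 2 * c * K) * (\<epsilon> + \<delta>)"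
          by (simp add: algebra_simps)
        then show "(2 * c * (\<epsilon> + \<delta>) + 2 * c * \<epsilon> * K) / (1 - q) \<le> (2 * c + 2 * c * K) / (1 - q) * (\<epsilon> + \<delta>)"
          using q by (simp add: divide_right_mono)
      qed
      finally show ?thesis .
    qed
    then show ?thesis by blast
  qed
  then show ?thesis by blast
qed

end
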